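(* Let $d<0$ be the discriminant of an imaginary quadratic field and let $d=q_1^*\cdots q_t^*$ be its factorization into prime discriminants. Assume that $q_1^*=8$, that $q_2^*,\dots,q_t^*$ are odd, and that the numbering is such that $q_i^*>0$ for $1\le i\le u$ and $q_i^*<0$ for $u<i\le t$, where $1\le u\le t-1$. Let $K_G=\mathbb Q(\sqrt{q_1^*},\dots,\sqrt{q_t^*})\subset\mathbb C$. 1. Define, for $(s_1,\dots,s_{t-1})\in\{0,1\}^{t-1}$, $$\beta_{s_1,\dots,s_{t-1}}=\sqrt2^{\,s_1}\left(\prod_{i=2}^u\tilde\alpha_i^{s_i}\alpha_i^{1-s_i}\right)\left(\left(\prod_{i=u+1}^{t-1}\tilde\alpha_i^{s_i}\alpha_i^{1-s_i}\right)\alpha_t+\left(\prod_{i=u+1}^{t-1}\tilde\alpha_i^{1-s_i}\alpha_i^{s_i}\right)\tilde\alpha_t\right).$$ The set $\{\beta_{s_1,\dots,s_{t-1}}:(s_1,\dots,s_{t-1})\in\{0,1\}^{t-1}\}$ is a $\mathbb Z$-basis of the ring of integers of $K_G\cap\mathbb R$. 2. Define $$\beta^*_{s_1,\dots,s_{t-1}}=\sqrt2^{\,1-s_1}\left(\prod_{i=2}^u(-\tilde\alpha_i)^{s_i}\alpha_i^{1-s_i}\right)\left(\left(\prod_{i=u+1}^{t-1}(-\tilde\alpha_i)^{s_i}\alpha_i^{1-s_i}\right)\alpha_t-\left(\prod_{i=u+1}^{t-1}\tilde\alpha_i^{1-s_i}(-\alpha_i)^{s_i}\right)\tilde\alpha_t\right).$$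 The set $\{\beta^*_{s_1,\dots,s_{t-1}}:(s_1,\dots,s_{t-1})\in\{0,1\}^{t-1}\}$ is a $\mathbb Z$-basis of the $\mathbb Z$-module $\mathcal O_{K_G}\cap i\mathbb R$. 3. For any $\eta,\nu\in\{0,1\}^{t-1}$, $$\sum_{\mu\in\{0,1\}^{t-1}}(-1)^{\mu_1+\dots+\mu_{t-1}}\tau_\mu\left(\beta_{\eta_1,\dots,\eta_{t-1}}\beta^*_{\nu_1,\dots,\nu_{t-1}}\right)=\begin{cases}\sqrt d,&\text{if }\eta=\nu,\\0,&\text{otherwise.}\end{cases}$$
   Context: The factorization of $d$ into prime discriminants is the unique (up to order) representation $d=q_1^*\cdots q_t^*$ with pairwise relatively prime $q_i^*$, each being either $(-1)^{(q-1)/2}q$ for an odd prime $q>0$ or an element of $\{-4,8,-8\}$. Fix a complex square root $\sqrt{q_i^*}$ for each $i$, with $\sqrt{q_1^*}=2\sqrt2$; $\sqrt d$ denotes the square root of $d$ equal to $\sqrt{q_1^*}\cdots\sqrt{q_t^*}$. For $i\ge2$ put $\alpha_i=\frac{1+\sqrt{q_i^*}}2$, $\tilde\alpha_i=\frac{1-\sqrt{q_i^*}}2$. One has $[K_G:\mathbb Q]=2^t$, and for $1\le j\le t$, $\tau_j\in\mathrm{Gal}(K_G/\mathbb Q)$ is the automorphism with $\tau_j(\sqrt{q_j^*})=-\sqrt{q_j^*}$ and $\tau_j(\sqrt{q_i^*})=\sqrt{q_i^*}$ for $i\neq j$. For $\lambda\in\{0,1\}^{t-1}$, $\tau_\lambda=\tau_1^{\lambda_1}\cdots\tau_{t-1}^{\lambda_{t-1}}$.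 $\mathcal O_{K_G}$ is the ring of integers of $K_G$. Empty products equal $1$. *)

theory Defs
  imports Complex_Main "HOL-Computational_Algebra.Computational_Algebra" "HOL-Library.FuncSet"
begin

global_interpretation int_mod: module "\<lambda>(n::int) (z::complex). of_int n * z"
  by unfold_locales (simp_all add: algebra_simps)

global_interpretation rat_vs: vector_space "\<lambda>(r::rat) (z::complex). of_rat r * z"
  by unfold_locales (simp_all add: algebra_simps of_rat_add of_rat_mult)

definition Z_basis :: "complex set \<Rightarrow> complex set \<Rightarrow> bool" where
  "Z_basis B M \<longleftrightarrow> int_mod.independent B \<and> int_mod.span B = M"

definition is_subfield :: "complex set \<Rightarrow> bool" where
  "is_subfield F \<longleftrightarrow> 1 \<in> F \<and>
     (\<forall>x\<in>F. \<forall>y\<in>F. x - y \<in> F \<and> x * y \<in> F) \<and> (\<forall>x\<in>F. inverse x \<in> F)"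

definition field_gen :: "complex set \<Rightarrow> complex set" where
  "field_gen S = is_subfield hull S"

definition ring_of_integers :: "complex set \<Rightarrow> complex set" where
  "ring_of_integers F = {x \<in> F. algebraic_int x}"

text \<open>The elements of Gal(F/Q) are taken to be extensional, so that an
  automorphism is determined by its values on \<open>F\<close>.\<close>

definition Gal :: "complex set \<Rightarrow> (complex \<Rightarrow> complex) set" where
  "Gal F = {\<sigma> \<in> extensional F. bij_betw \<sigma> F F \<and>
     (\<forall>x\<in>F. \<forall>y\<in>F. \<sigma> (x + y) = \<sigma> x + \<sigma> y \<and> \<sigma> (x * y) = \<sigma> x * \<sigma> y) \<and>
     (\<forall>x\<in>\<rat>. \<sigma> x = x)}"

definition imaginary_quadratic_field :: "complex set \<Rightarrow> bool" where
  "imaginary_quadratic_field F \<longleftrightarrow> is_subfield F \<and> rat_vs.dim F = 2 \<and> \<not> F \<subseteq> \<real>"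

text \<open>The two embeddings of an imaginary quadratic field into the complex numbers are the
  inclusion and complex conjugation, so its discriminant is the square of the determinant of
  the matrix with rows \<open>(w1, w2)\<close> and \<open>(cnj w1, cnj w2)\<close> for an integral basis \<open>w1, w2\<close>.\<close>

definition imaginary_quadratic_discriminant :: "int \<Rightarrow> bool" where
  "imaginary_quadratic_discriminant d \<longleftrightarrow>
     (\<exists>F w1 w2. imaginary_quadratic_field F \<and> Z_basis {w1, w2} (ring_of_integers F) \<and>
        of_int d = (w1 * cnj w2 - w2 * cnj w1) ^ 2)"

definition prime_discriminant :: "int \<Rightarrow> bool" where
  "prime_discriminant a \<longleftrightarrow>
     (\<exists>p::nat. prime p \<and> odd p \<and> a = (- 1) ^ ((p - 1) div 2) * int p) \<or> a \<in> {- 4, 8, - 8}"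

definition prime_discriminant_factorization :: "int \<Rightarrow> nat \<Rightarrow> (nat \<Rightarrow> int) \<Rightarrow> bool" where
  "prime_discriminant_factorization d t q \<longleftrightarrow>
     d = (\<Prod>i\<in>{1..t}. q i) \<and> (\<forall>i\<in>{1..t}. prime_discriminant (q i)) \<and>
     pairwise (\<lambda>i j. coprime (q i) (q j)) {1..t}"

text \<open>In what follows \<open>r i\<close> is the chosen square root of the \<open>i\<close>-th prime discriminant;
  only the indices from 1 to \<open>t\<close> matter.\<close>

definition genus_field :: "(nat \<Rightarrow> complex) \<Rightarrow> nat \<Rightarrow> complex set" where
  "genus_field r t = field_gen (r ` {1..t})"

definition alpha :: "(nat \<Rightarrow> complex) \<Rightarrow> nat \<Rightarrow> complex" where
  "alpha r i = (1 + r i) / 2"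

definition alpha' :: "(nat \<Rightarrow> complex) \<Rightarrow> nat \<Rightarrow> complex" where
  "alpha' r i = (1 - r i) / 2"

definition tau :: "(nat \<Rightarrow> complex) \<Rightarrow> nat \<Rightarrow> nat \<Rightarrow> complex \<Rightarrow> complex" where
  "tau r t j = (THE \<sigma>. \<sigma> \<in> Gal (genus_field r t) \<and>
     (\<forall>i\<in>{1..t}. \<sigma> (r i) = (if i = j then - r i else r i)))"

definition tau_vec :: "(nat \<Rightarrow> complex) \<Rightarrow> nat \<Rightarrow> (nat \<Rightarrow> nat) \<Rightarrow> complex \<Rightarrow> complex" where
  "tau_vec r t \<mu> = foldr (\<circ>) (map (\<lambda>j. tau r t j ^^ \<mu> j) [1..<t]) id"

definition bit_vecs :: "nat \<Rightarrow> (nat \<Rightarrow> nat) set" where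
  "bit_vecs n = ({1..n} \<rightarrow>\<^sub>E {0, 1})"

definition beta :: "(nat \<Rightarrow> complex) \<Rightarrow> nat \<Rightarrow> nat \<Rightarrow> (nat \<Rightarrow> nat) \<Rightarrow> complex" where
  "beta r u t s =
     complex_of_real (sqrt 2) ^ s 1 *
     (\<Prod>i\<in>{2..u}. alpha' r i ^ s i * alpha r i ^ (1 - s i)) *
     ((\<Prod>i\<in>{u+1..t-1}. alpha' r i ^ s i * alpha r i ^ (1 - s i)) * alpha r t +
      (\<Prod>i\<in>{u+1..t-1}. alpha' r i ^ (1 - s i) * alpha r i ^ s i) * alpha' r t)"

definition beta_star :: "(nat \<Rightarrow> complex) \<Rightarrow> nat \<Rightarrow> nat \<Rightarrow> (nat \<Rightarrow> nat) \<Rightarrow> complex" where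
  "beta_star r u t s =
     complex_of_real (sqrt 2) ^ (1 - s 1) *
     (\<Prod>i\<in>{2..u}. (- alpha' r i) ^ s i * alpha r i ^ (1 - s i)) *
     ((\<Prod>i\<in>{u+1..t-1}. (- alpha' r i) ^ s i * alpha r i ^ (1 - s i)) * alpha r t -
      (\<Prod>i\<in>{u+1..t-1}. alpha' r i ^ (1 - s i) * (- alpha r i) ^ s i) * alpha' r t)"

end

theory Submission
  imports Defs "Jordan_Normal_Form.Char_Poly"
begin

text \<open>
  Write \<open>K\<close> for the genus field. Every odd prime discriminant \<open>q\<^sub>i\<close> is congruent to 1 modulo 4, so
  the conjugate elements \<open>\<alpha>\<^sub>i\<close> and \<open>\<alpha>\<^sub>i'\<close> are integral, and the two of them span
  \<open>\<rat>(\<surd>q\<^sub>i)\<close> over \<open>\<rat>\<close>. The products of one of \<open>\<alpha>\<^sub>i\<close>, \<open>\<alpha>\<^sub>i'\<close> for each \<open>i < t\<close> (one of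
  \<open>1\<close>, \<open>\<surd>2\<close> for \<open>i = 1\<close>) therefore span \<open>\<rat>(\<surd>q\<^sub>1, \<dots>, \<surd>q\<^sub>t\<^sub>-\<^sub>1)\<close>. Since complex conjugation
  interchanges \<open>\<alpha>\<^sub>t\<close> and \<open>\<alpha>\<^sub>t'\<close>, each real element of \<open>K\<close> has the form \<open>Y \<alpha>\<^sub>t + cnj (Y \<alpha>\<^sub>t)\<close> and
  each imaginary one the form \<open>Y \<alpha>\<^sub>t - cnj (Y \<alpha>\<^sub>t)\<close>, with \<open>Y\<close> in that smaller field. Taking for
  \<open>Y\<close> the products gives the families \<open>beta\<close> and \<open>beta_star\<close>, up to signs and the exchange of \<open>1\<close>
  and \<open>\<surd>2\<close>; so they span the real and the imaginary part of \<open>K\<close> over \<open>\<rat>\<close>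
  (\<open>rational_expansion\<close>).

  The heart of the matter is the third claim, that the two families are dual to each other with
  respect to the alternating sum over the automorphisms \<open>\<tau>\<^sub>\<mu>\<close>. On a product of local factors this
  sum is the product of the local alternating sums \<open>g(\<surd>q\<^sub>i) - g(- \<surd>q\<^sub>i)\<close>, which are odd in \<open>\<surd>q\<^sub>i\<close>.
  On \<open>\<surd>q\<^sub>1, \<dots>, \<surd>q\<^sub>t\<^sub>-\<^sub>1\<close> complex conjugation acts as an even number of sign changes, because
  \<open>d < 0\<close> makes the total number of negative \<open>q\<^sub>i\<close> odd and \<open>q\<^sub>t\<close> is one of them. By
  oddness the alternating sum does not see it, so among the four terms of \<open>(E \<alpha>\<^sub>t + cnj (E \<alpha>\<^sub>t)) (E\<^sup>* \<alpha>\<^sub>t - cnj (E\<^sup>* \<alpha>\<^sub>t))\<close> the mixed ones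
  cancel, and the pure ones combine to \<open>\<alpha>\<^sub>t\<^sup>2 - \<alpha>\<^sub>t'\<^sup>2 = \<surd>q\<^sub>t\<close> times the product of the local sums
  (\<open>alternating_beta_beta_star\<close>). Linear independence of both families is immediate from the
  duality.

  It remains to see that an algebraic integer has integral coordinates. Summing only over the
  automorphisms that fix \<open>\<surd>2\<close>, the duality extracts from an integer \<open>x\<close> the algebraic integer
  \<open>(a + b \<surd>2) \<surd>m\<close>, where \<open>a\<close> and \<open>b\<close> are two rational coordinates of \<open>x\<close> and \<open>m = q\<^sub>2 \<dots> q\<^sub>t\<close> is
  odd and squarefree. The conjugate \<open>(a - b \<surd>2) \<surd>m\<close> is integral as well, and these two facts
  force \<open>a\<close> and \<open>b\<close> to be integers (\<open>sqrt2_integer_coefficients\<close>).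

  The automorphisms exist and are unique because the square roots are independent: no product of
  a nonempty set of them is rational, and by induction none lies in the field generated by the
  others (\<open>prod_sqrt_notin_field_gen\<close>).
\<close>

section \<open>The ring of algebraic integers\<close>

text \<open>
  Multiplication by \<open>z\<close> acts on the finite generating set \<open>S\<close> through an integer matrix, of which \<open>z\<close>
  is an eigenvalue with the vector of the generators as eigenvector. So \<open>z\<close> is a root of the
  characteristic polynomial, which is monic with integer coefficients.
\<close>

lemma algebraic_int_if_stabilizes_span:
  fixes z :: complex
  assumes S: "finite S" "s0 \<in> S" "s0 \<noteq> 0" and stable: "\<And>s. s \<in> S \<Longrightarrow> z * s \<in> int_mod.span S"
  shows "algebraic_int z"
proof -
  define n where "n = card S"
  obtain e where e: "bij_betw e {0..<n} S"
    using ex_bij_betw_nat_finite[OF S(1)] unfolding n_def by blast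
  have "\<exists>u. z * s = (\<Sum>v\<in>S. of_int (u v) * v)" if "s \<in> S" for s
    using stable[OF that] unfolding int_mod.span_finite[OF S(1)] by auto
  then obtain M where M: "\<And>s. s \<in> S \<Longrightarrow> z * s = (\<Sum>v\<in>S. of_int (M s v) * v)"
    by metis
  define B :: "int mat" where "B = mat n n (\<lambda>(i, j). M (e i) (e j))"
  define A :: "complex mat" where "A = map_mat of_int B"
  define v where "v = vec n e"
  have B: "B \<in> carrier_mat n n" and A: "A \<in> carrier_mat n n"
    by (auto simp: B_def A_def)
  have eS: "e i \<in> S" if "i < n" for i
    using e that by (auto simp: bij_betw_def)
  have "A *\<^sub>v v = z \<cdot>\<^sub>v v"
  proof (rule eq_vecI)
    fix i assume "i < dim_vec (z \<cdot>\<^sub>v v)"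
    then have i: "i < n" by (simp add: v_def)
    have "(A *\<^sub>v v) $ i = (\<Sum>j\<in>{0..<n}. of_int (M (e i) (e j)) * e j)"
      using i by (simp add: A_def B_def v_def scalar_prod_def)
    also have "\<dots> = (\<Sum>w\<in>S. of_int (M (e i) w) * w)"
      by (rule sum.reindex_bij_betw[OF e])
    finally show "(A *\<^sub>v v) $ i = (z \<cdot>\<^sub>v v) $ i"
      using i M[OF eS[OF i]] by (simp add: v_def)
  qed (simp add: A_def B_def v_def)
  moreover have "v \<noteq> 0\<^sub>v n"
  proof
    assume eq: "v = 0\<^sub>v n"
    obtain i where "i < n" "e i = s0"
      using e S(2) by (auto simp: bij_betw_def)
    then have "v $ i = s0" by (simp add: v_def)
    with eq \<open>i < n\<close> S(3) show False by simp
  qed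
  ultimately have "eigenvalue A z"
    unfolding eigenvalue_def eigenvector_def using A by (intro exI[of _ v]) (auto simp: v_def)
  then have "poly (char_poly A) z = 0"
    by (simp add: eigenvalue_root_char_poly[OF A])
  moreover have "char_poly A = of_int_poly (char_poly B)"
    unfolding A_def by (rule of_int_hom.char_poly_hom[OF B])
  moreover have "lead_coeff (char_poly B) = 1"
    using degree_monic_char_poly[OF B] by simp
  ultimately show ?thesis
    unfolding algebraic_int_altdef_ipoly by metis
qed

lemma algebraic_int_power_reduce:
  fixes x :: complex
  assumes "algebraic_int x"
  obtains m c where "m > 0" "x ^ m = (\<Sum>i<m. of_int (c i) * x ^ i)"
proof -
  obtain p where p: "poly (of_int_poly p) x = 0" "lead_coeff p = 1"
    using assms unfolding algebraic_int_altdef_ipoly by blast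
  let ?m = "degree p"
  have eq: "0 = (\<Sum>i<?m. of_int (coeff p i) * x ^ i) + x ^ ?m"
    using p by (simp add: poly_altdef lessThan_Suc_atMost[symmetric])
  have "?m > 0"
    using eq by (cases "?m") auto
  moreover have "x ^ ?m = (\<Sum>i<?m. of_int (- coeff p i) * x ^ i)"
    using eq by (simp add: sum_negf add_eq_0_iff2)
  ultimately show ?thesis by (rule that)
qed

text \<open>
  The products \<open>x\<^sup>i y\<^sup>j\<close> with exponents below the degrees of monic equations for \<open>x\<close> and \<open>y\<close> generate
  an additive group that is stable under multiplication by \<open>x\<close> and by \<open>y\<close>, hence also by their sum
  and by their product.
\<close>

lemma algebraic_int_plus_times:
  fixes x y :: complex
  assumes "algebraic_int x" "algebraic_int y"
  shows "algebraic_int (x + y)" "algebraic_int (x * y)"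
proof -
  obtain m c where m: "m > 0" "x ^ m = (\<Sum>i<m. of_int (c i) * x ^ i)"
    using algebraic_int_power_reduce[OF assms(1)] .
  obtain n d where n: "n > 0" "y ^ n = (\<Sum>i<n. of_int (d i) * y ^ i)"
    using algebraic_int_power_reduce[OF assms(2)] .
  define S where "S = (\<lambda>(i, j). x ^ i * y ^ j) ` ({..<m} \<times> {..<n})"
  have SI: "x ^ i * y ^ j \<in> int_mod.span S" if "i < m" "j < n" for i j
    using that by (intro int_mod.span_base) (auto simp: S_def)
  have x: "x * (x ^ i * y ^ j) \<in> int_mod.span S" if "i < m" "j < n" for i j
  proof (cases "Suc i < m")
    case False
    then have "Suc i = m" using that by simp
    then have "x * (x ^ i * y ^ j) = x ^ m * y ^ j"
      by auto
    also have "\<dots> = (\<Sum>i<m. of_int (c i) * (x ^ i * y ^ j))"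
      unfolding m(2) by (simp add: sum_distrib_right mult.assoc)
    also have "\<dots> \<in> int_mod.span S"
      using that SI by (intro int_mod.span_sum int_mod.span_scale) auto
    finally show ?thesis .
  qed (use SI[of "Suc i" j] that in \<open>simp add: mult_ac\<close>)
  have y: "y * (x ^ i * y ^ j) \<in> int_mod.span S" if "i < m" "j < n" for i j
  proof (cases "Suc j < n")
    case False
    then have "Suc j = n" using that by simp
    then have "y * (x ^ i * y ^ j) = x ^ i * y ^ n"
      by auto
    also have "\<dots> = (\<Sum>j<n. of_int (d j) * (x ^ i * y ^ j))"
      unfolding n(2) by (simp add: sum_distrib_left mult_ac)
    also have "\<dots> \<in> int_mod.span S"
      using that SI by (intro int_mod.span_sum int_mod.span_scale) auto
    finally show ?thesis .
  qed (use SI[of i "Suc j"] that in \<open>simp add: mult_ac\<close>)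
  have ext: "z * w \<in> int_mod.span S"
    if "\<And>i j. i < m \<Longrightarrow> j < n \<Longrightarrow> z * (x ^ i * y ^ j) \<in> int_mod.span S" "w \<in> int_mod.span S" for z w
    using that(2)
  proof (induction rule: int_mod.span_induct_alt)
    case (step k a b)
    then have "z * a \<in> int_mod.span S"
      using that(1) by (auto simp: S_def)
    then have "of_int k * (z * a) + z * b \<in> int_mod.span S"
      using step by (intro int_mod.span_add int_mod.span_scale)
    then show ?case by (simp add: algebra_simps)
  qed (simp add: int_mod.span_zero)
  have fin: "finite S" and one: "1 \<in> S"
    using m(1) n(1) by (auto simp: S_def intro!: image_eqI[of _ _ "(0, 0)"])
  show "algebraic_int (x + y)"
  proof (rule algebraic_int_if_stabilizes_span[OF fin one])
    fix s assume "s \<in> S"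
    then have "x * s + y * s \<in> int_mod.span S"
      using x y by (intro int_mod.span_add) (auto simp: S_def)
    then show "(x + y) * s \<in> int_mod.span S" by (simp add: algebra_simps)
  qed simp
  show "algebraic_int (x * y)"
  proof (rule algebraic_int_if_stabilizes_span[OF fin one])
    fix s assume "s \<in> S"
    then have "y * s \<in> int_mod.span S"
      using y by (auto simp: S_def)
    with x have "x * (y * s) \<in> int_mod.span S"
      by (rule ext)
    then show "x * y * s \<in> int_mod.span S" by (simp add: algebra_simps)
  qed simp
qed

lemmas algebraic_int_plus = algebraic_int_plus_times(1)
lemmas algebraic_int_times = algebraic_int_plus_times(2)

lemma algebraic_int_of_int: "algebraic_int (of_int n :: complex)"
  by (rule int_imp_algebraic_int) simp

lemma algebraic_int_sum:
  fixes f :: "'a \<Rightarrow> complex"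
  shows "(\<And>i. i \<in> A \<Longrightarrow> algebraic_int (f i)) \<Longrightarrow> algebraic_int (\<Sum>i\<in>A. f i)"
  by (induction A rule: infinite_finite_induct) (auto intro: algebraic_int_plus)

lemma algebraic_int_prod:
  fixes f :: "'a \<Rightarrow> complex"
  shows "(\<And>i. i \<in> A \<Longrightarrow> algebraic_int (f i)) \<Longrightarrow> algebraic_int (\<Prod>i\<in>A. f i)"
  by (induction A rule: infinite_finite_induct)
    (auto intro: algebraic_int_times int_imp_algebraic_int)

lemma algebraic_int_power:
  fixes x :: complex
  shows "algebraic_int x \<Longrightarrow> algebraic_int (x ^ n)"
  by (induction n) (auto intro: algebraic_int_times int_imp_algebraic_int)

lemma algebraic_int_diff:
  fixes x y :: complex
  shows "algebraic_int x \<Longrightarrow> algebraic_int y \<Longrightarrow> algebraic_int (x - y)"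
  using algebraic_int_plus[of x "- y"] by simp

section \<open>Spans and bases of indexed families\<close>

text \<open>
  Coordinates are indexed by \<open>A\<close>, so that a value taken twice by the family still has two separate
  coordinates.
\<close>

lemma (in Modules.module) span_image_eq_sums:
  assumes "finite A"
  shows "span (f ` A) = {\<Sum>i\<in>A. c i *s f i | c. True}" (is "_ = ?R")
proof
  show "?R \<subseteq> span (f ` A)"
  proof safe
    show "(\<Sum>i\<in>A. c i *s f i) \<in> span (f ` A)" for c
      by (intro span_sum span_scale span_base imageI)
  qed
  have "f ` A \<subseteq> ?R"
  proof
    fix x assume "x \<in> f ` A"
    then obtain i where "i \<in> A" "x = f i" by auto
    then have "x = (\<Sum>j\<in>A. (if j = i then 1 else 0) *s f j)"
      using assms by (simp add: if_distrib[of "\<lambda>c. c *s _"] sum.delta' cong: if_cong)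
    then show "x \<in> ?R" by (intro CollectI exI[of _ "\<lambda>j. if j = i then 1 else 0"]) simp
  qed
  moreover have "subspace ?R"
  proof (rule subspaceI)
    show "0 \<in> ?R" by (auto intro!: exI[of _ "\<lambda>_. 0"])
    show "x + y \<in> ?R" if xy: "x \<in> ?R" "y \<in> ?R" for x y
    proof -
      obtain c d where "x = (\<Sum>i\<in>A. c i *s f i)" "y = (\<Sum>i\<in>A. d i *s f i)" using xy by auto
      then have "x + y = (\<Sum>i\<in>A. (c i + d i) *s f i)"
        by (simp add: scale_left_distrib sum.distrib)
      then show ?thesis by (intro CollectI exI[of _ "\<lambda>i. c i + d i"]) simp
    qed
    show "a *s x \<in> ?R" if x: "x \<in> ?R" for a x
    proof -
      obtain c where "x = (\<Sum>i\<in>A. c i *s f i)" using x by auto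
      then have "a *s x = (\<Sum>i\<in>A. (a * c i) *s f i)"
        by (simp add: scale_sum_right)
      then show ?thesis by (intro CollectI exI[of _ "\<lambda>i. a * c i"]) simp
    qed
  qed
  ultimately show "span (f ` A) \<subseteq> ?R"
    by (rule span_minimal)
qed

text \<open>
  The hypothesis on coefficients indexed by \<open>A\<close> also yields the injectivity of \<open>f\<close>, which is what
  makes it a statement about the set of values.
\<close>

lemma (in Modules.module) independent_image:
  fixes f :: "'c \<Rightarrow> 'b"
  assumes A: "finite A"
    and zero: "\<And>c i. (\<Sum>i\<in>A. c i *s f i) = 0 \<Longrightarrow> i \<in> A \<Longrightarrow> c i = 0"
    and one: "(1 :: 'a) \<noteq> 0"
  shows "independent (f ` A)"
proof -
  have inj: "inj_on f A"
  proof (rule inj_onI, rule ccontr)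
    fix i j assume ij: "i \<in> A" "j \<in> A" "f i = f j" "i \<noteq> j"
    define c :: "'c \<Rightarrow> 'a" where "c k = (if k = i then 1 else 0) - (if k = j then 1 else 0)" for k
    have "(\<Sum>k\<in>A. c k *s f k) = f i - f j"
      using ij A by (simp add: c_def scale_left_diff_distrib sum_subtractf if_distrib[of "\<lambda>c. c *s _"] cong: if_cong)
    then have "c i = 0" using ij zero[of c i] by simp
    with ij one show False by (simp add: c_def)
  qed
  show ?thesis
    unfolding independent_explicit_module
  proof (intro allI impI)
    fix T u v assume T: "finite T" "T \<subseteq> f ` A" "(\<Sum>v\<in>T. u v *s v) = 0" "v \<in> T"
    let ?c = "\<lambda>i. if f i \<in> T then u (f i) else 0"
    have "(\<Sum>i\<in>A. ?c i *s f i) = (\<Sum>v\<in>f ` A. (if v \<in> T then u v else 0) *s v)"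
      using inj by (simp add: sum.reindex)
    also have "\<dots> = (\<Sum>v\<in>T. u v *s v)"
      using T A by (intro sum.mono_neutral_cong_right) auto
    finally have "(\<Sum>i\<in>A. ?c i *s f i) = 0" using T by simp
    then have "?c i = 0" if "i \<in> A" for i by (rule zero) (rule that)
    moreover obtain i where "i \<in> A" "v = f i" using T by auto
    ultimately show "u v = 0" using T(4) by force
  qed
qed

text \<open>
  The pattern in which both bases are obtained: coordinates exist over \<open>\<rat>\<close>, and those of the elements
  of \<open>M\<close> turn out to be integers.
\<close>

lemma Z_basisI:
  fixes f :: "'a \<Rightarrow> complex"
  assumes indep: "int_mod.independent (f ` A)"
    and M: "\<And>x y. x \<in> M \<Longrightarrow> y \<in> M \<Longrightarrow> x + y \<in> M" "\<And>n x. x \<in> M \<Longrightarrow> of_int n * x \<in> M"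
    and f: "\<And>s. f s \<in> M"
    and expand: "\<And>x. x \<in> M \<Longrightarrow> \<exists>c. x = (\<Sum>s\<in>A. of_rat (c s) * f s)"
    and int: "\<And>c s. (\<Sum>s\<in>A. of_rat (c s) * f s) \<in> M \<Longrightarrow> s \<in> A \<Longrightarrow>
      (of_rat (c s) :: complex) \<in> \<int>"
  shows "Z_basis (f ` A) M"
proof -
  have "0 \<in> M" using M(2)[OF f, of 0] by simp
  then have "int_mod.subspace M"
    using M by (intro int_mod.subspaceI) auto
  then have "int_mod.span (f ` A) \<subseteq> M"
    using f by (intro int_mod.span_minimal) auto
  moreover have "M \<subseteq> int_mod.span (f ` A)"
  proof
    fix x assume x: "x \<in> M"
    then obtain c where c: "x = (\<Sum>s\<in>A. of_rat (c s) * f s)" using expand by blast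
    have "of_rat (c s) * f s \<in> int_mod.span (f ` A)" if s: "s \<in> A" for s
    proof -
      have "(of_rat (c s) :: complex) \<in> \<int>"
        using x s unfolding c by (rule int)
      then obtain n where n: "(of_rat (c s) :: complex) = of_int n"
        by (auto elim: Ints_cases)
      show ?thesis
        unfolding n by (intro int_mod.span_scale int_mod.span_base imageI s)
    qed
    then show "x \<in> int_mod.span (f ` A)"
      unfolding c by (rule int_mod.span_sum)
  qed
  ultimately show ?thesis using indep by (auto simp: Z_basis_def)
qed

section \<open>Subfields generated by square roots\<close>

lemma is_subfield_hull: "is_subfield (is_subfield hull S)"
  by (rule hull_in) (auto simp: is_subfield_def)

lemma is_subfield_field_gen: "is_subfield (field_gen S)"
  unfolding field_gen_def by (rule is_subfield_hull)

context
  fixes F assumes F: "is_subfield F"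
begin

lemma subfield_1: "1 \<in> F"
  using F by (simp add: is_subfield_def)

lemma subfield_diff: "x \<in> F \<Longrightarrow> y \<in> F \<Longrightarrow> x - y \<in> F"
  using F by (simp add: is_subfield_def)

lemma subfield_mult: "x \<in> F \<Longrightarrow> y \<in> F \<Longrightarrow> x * y \<in> F"
  using F by (simp add: is_subfield_def)

lemma subfield_inverse: "x \<in> F \<Longrightarrow> inverse x \<in> F"
  using F by (simp add: is_subfield_def)

lemma subfield_0: "0 \<in> F"
  using subfield_diff[OF subfield_1 subfield_1] by simp

lemma subfield_uminus: "x \<in> F \<Longrightarrow> - x \<in> F"
  using subfield_diff[OF subfield_0] by simp

lemma subfield_add: "x \<in> F \<Longrightarrow> y \<in> F \<Longrightarrow> x + y \<in> F"
  using subfield_diff[of x "- y"] subfield_uminus by simp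

lemma subfield_divide: "x \<in> F \<Longrightarrow> y \<in> F \<Longrightarrow> x / y \<in> F"
  by (simp add: divide_inverse subfield_mult subfield_inverse)

lemma subfield_of_nat: "of_nat n \<in> F"
  by (induction n) (auto intro: subfield_0 subfield_1 subfield_add)

lemma subfield_of_int: "of_int n \<in> F"
  by (cases n rule: int_cases2) (auto intro: subfield_of_nat subfield_uminus)

lemma subfield_numeral: "numeral k \<in> F"
  using subfield_of_nat[of "numeral k"] by simp

lemma subfield_Rats: "\<rat> \<subseteq> F"
  by (auto elim!: Rats_cases' intro: subfield_divide subfield_of_int)

lemma subfield_power: "x \<in> F \<Longrightarrow> x ^ n \<in> F"
  by (induction n) (auto intro: subfield_1 subfield_mult)

lemma subfield_sum: "(\<And>i. i \<in> A \<Longrightarrow> f i \<in> F) \<Longrightarrow> (\<Sum>i\<in>A. f i) \<in> F"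
  by (induction A rule: infinite_finite_induct) (auto intro: subfield_0 subfield_add)

lemma subfield_prod: "(\<And>i. i \<in> A \<Longrightarrow> f i \<in> F) \<Longrightarrow> (\<Prod>i\<in>A. f i) \<in> F"
  by (induction A rule: infinite_finite_induct) (auto intro: subfield_1 subfield_mult)

text \<open>
  Inverses come from the norm \<open>a\<^sup>2 - b\<^sup>2 w\<^sup>2\<close>. If it vanishes because \<open>a = b w\<close>, which can happen
  for \<open>w\<close> in \<open>F\<close>, the element is \<open>2 a\<close> and has its inverse in \<open>F\<close>.
\<close>

lemma is_subfield_adjoin_sqrt:
  assumes w: "w ^ 2 \<in> F"
  shows "is_subfield {a + b * w | a b. a \<in> F \<and> b \<in> F}" (is "is_subfield ?G")
proof -
  note sf = subfield_0 subfield_1 subfield_diff subfield_mult subfield_add subfield_uminus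
    subfield_inverse subfield_divide subfield_numeral
  have GI: "a \<in> F \<Longrightarrow> b \<in> F \<Longrightarrow> x = a + b * w \<Longrightarrow> x \<in> ?G" for a b x
    by blast
  have "inverse (a + b * w) \<in> ?G" if ab: "a \<in> F" "b \<in> F" for a b
  proof (cases "a = b * w")
    case True
    then have "inverse (a + b * w) = inverse (2 * a) + 0 * w"
      by simp
    then show ?thesis
      by (rule GI[rotated 2]) (intro sf ab)+
  next
    case ne: False
    show ?thesis
    proof (cases "a + b * w = 0")
      case False
      define N where "N = a ^ 2 - b ^ 2 * w ^ 2"
      have N: "N = (a + b * w) * (a - b * w)"
        by (simp add: N_def power2_eq_square algebra_simps)
      then have "N \<noteq> 0" using ne False by simp
      moreover have "N \<in> F"
        unfolding N_def by (intro sf ab w subfield_power)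
      moreover have "inverse (a + b * w) = a / N + (- b / N) * w"
        using ne False by (simp add: N divide_simps)
      ultimately show ?thesis
        by (intro GI[of "a / N" "- b / N"] sf ab)
    next
      case True
      then have "inverse (a + b * w) = 0 + 0 * w" by simp
      then show ?thesis by (rule GI[rotated 2]) (intro sf)+
    qed
  qed
  moreover have "(a + b * w) * (c + e * w) \<in> ?G" if "a \<in> F" "b \<in> F" "c \<in> F" "e \<in> F" for a b c e
  proof -
    have "(a + b * w) * (c + e * w) = (a * c + b * e * w ^ 2) + (a * e + b * c) * w"
      by (simp add: power2_eq_square algebra_simps)
    then show ?thesis by (rule GI[rotated 2]) (intro sf w that)+
  qed
  moreover have "(a + b * w) - (c + e * w) \<in> ?G" if "a \<in> F" "b \<in> F" "c \<in> F" "e \<in> F" for a b c e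
  proof -
    have "(a + b * w) - (c + e * w) = (a - c) + (b - e) * w"
      by (simp add: algebra_simps)
    then show ?thesis by (rule GI[rotated 2]) (intro sf that)+
  qed
  moreover have "1 \<in> ?G"
  proof -
    have "1 = 1 + 0 * w" by simp
    then show ?thesis by (rule GI[rotated 2]) (intro sf)+
  qed
  ultimately show ?thesis
    unfolding is_subfield_def by (auto 0 3)
qed

end

lemma is_subfield_Rats: "is_subfield \<rat>"
  by (auto simp: is_subfield_def)

lemma field_gen_superset: "S \<subseteq> field_gen S"
  unfolding field_gen_def by (rule hull_subset)

lemma field_gen_minimal: "S \<subseteq> F \<Longrightarrow> is_subfield F \<Longrightarrow> field_gen S \<subseteq> F"
  unfolding field_gen_def by (rule hull_minimal)

lemma field_gen_mono: "S \<subseteq> T \<Longrightarrow> field_gen S \<subseteq> field_gen T"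
  unfolding field_gen_def by (rule hull_mono)

lemma field_gen_insert_sqrt:
  assumes w: "w ^ 2 \<in> field_gen S"
  shows "field_gen (insert w S) = {a + b * w | a b. a \<in> field_gen S \<and> b \<in> field_gen S}" (is "_ = ?G")
proof
  note F = is_subfield_field_gen[of S]
  have "insert w S \<subseteq> ?G"
  proof
    fix x assume "x \<in> insert w S"
    then show "x \<in> ?G"
    proof
      assume "x = w"
      then have "x = 0 + 1 * w" by simp
      then show ?thesis using subfield_0[OF F] subfield_1[OF F] by blast
    next
      assume "x \<in> S"
      then have "x = x + 0 * w" "x \<in> field_gen S" using field_gen_superset by auto
      then show ?thesis using subfield_0[OF F] by blast
    qed
  qed
  then show "field_gen (insert w S) \<subseteq> ?G"
    by (rule field_gen_minimal) (rule is_subfield_adjoin_sqrt[OF F w])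
  have "field_gen S \<subseteq> field_gen (insert w S)" "w \<in> field_gen (insert w S)"
    using field_gen_superset[of "insert w S"] by (auto intro!: field_gen_mono)
  then show "?G \<subseteq> field_gen (insert w S)"
    using is_subfield_field_gen by (auto intro!: subfield_add subfield_mult)
qed

lemma field_gen_empty: "field_gen {} = \<rat>"
  using field_gen_minimal[OF _ is_subfield_Rats, of "{}"] subfield_Rats[OF is_subfield_field_gen, of "{}"]
  by auto

text \<open>
  Independence of square roots. Suppose that \<open>w\<close>, the product over \<open>J\<close>, equals \<open>a + b r\<^sub>k\<close> with
  \<open>a\<close> and \<open>b\<close> in the field generated by the remaining roots. Its square is rational, so the mixed
  term \<open>2 a b r\<^sub>k\<close> lies in that field although \<open>r\<^sub>k\<close> does not; hence \<open>a = 0\<close> or \<open>b = 0\<close>. Then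
  \<open>r\<^sub>k w\<close> or \<open>w\<close> lies in the smaller field, and both are products over a set disjoint from the
  remaining indices.
\<close>

lemma prod_sqrt_notin_field_gen:
  fixes r :: "'a \<Rightarrow> complex"
  assumes "finite I" "finite J" "I \<inter> J = {}" "J \<noteq> {}"
    and sq: "\<And>i. i \<in> I \<union> J \<Longrightarrow> r i ^ 2 \<in> \<rat>"
    and irrat: "\<And>L. L \<subseteq> I \<union> J \<Longrightarrow> L \<noteq> {} \<Longrightarrow> (\<Prod>i\<in>L. r i) \<notin> \<rat>"
  shows "(\<Prod>i\<in>J. r i) \<notin> field_gen (r ` I)"
  using assms
proof (induction I arbitrary: J rule: finite_induct)
  case empty
  then show ?case by (simp add: field_gen_empty)
next
  case (insert k I)
  let ?F = "field_gen (r ` I)"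
  note F = is_subfield_field_gen[of "r ` I"]
  have irrat: "(\<Prod>i\<in>L. r i) \<notin> \<rat>" if "L \<subseteq> insert k (I \<union> J)" "L \<noteq> {}" for L
    using insert.prems(5)[of L] that by simp
  have k: "k \<notin> J"
    using insert.prems by auto
  have "(\<Prod>i\<in>{k}. r i) \<notin> ?F"
    using insert.hyps insert.prems(4) by (intro insert.IH irrat) auto
  then have kF: "r k \<notin> ?F" by simp
  have PJ: "(\<Prod>i\<in>J. r i) \<notin> ?F"
    using insert.prems(1-4) by (intro insert.IH irrat) auto
  have "(\<Prod>i\<in>insert k J. r i) \<notin> ?F"
    using insert.hyps insert.prems(1-4) by (intro insert.IH irrat) auto
  then have PkJ: "r k * (\<Prod>i\<in>J. r i) \<notin> ?F"
    using insert.prems(1) k by simp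
  have rk: "r k ^ 2 \<in> \<rat>" "r k ^ 2 \<in> ?F"
    using insert.prems subfield_Rats[OF F] by auto
  show ?case
  proof
    assume "(\<Prod>i\<in>J. r i) \<in> field_gen (r ` insert k I)"
    then obtain a b where ab: "a \<in> ?F" "b \<in> ?F" "(\<Prod>i\<in>J. r i) = a + b * r k"
      using field_gen_insert_sqrt[OF rk(2)] by auto
    have "(\<Prod>i\<in>J. r i) ^ 2 \<in> \<rat>"
      unfolding prod_power_distrib by (intro subfield_prod[OF is_subfield_Rats] insert.prems(4)) auto
    then have PF: "(\<Prod>i\<in>J. r i) ^ 2 \<in> ?F"
      using subfield_Rats[OF F] by auto
    have "b = 0"
    proof (rule ccontr)
      assume "b \<noteq> 0"
      show False
      proof (cases "a = 0")
        case True
        then have "r k * (\<Prod>i\<in>J. r i) = b * r k ^ 2"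
          using ab by (simp add: power2_eq_square)
        then show False using PkJ ab rk subfield_mult[OF F] by auto
      next
        case False
        have "(a + b * r k) ^ 2 = a ^ 2 + b ^ 2 * r k ^ 2 + 2 * a * b * r k"
          by (simp add: power2_eq_square algebra_simps)
        then have "r k = ((a + b * r k) ^ 2 - a ^ 2 - b ^ 2 * r k ^ 2) / (2 * a * b)"
          using False \<open>b \<noteq> 0\<close> by (simp add: field_simps)
        also have "\<dots> \<in> ?F"
          using PF ab rk
          by (auto intro!: subfield_divide[OF F] subfield_diff[OF F] subfield_mult[OF F]
              subfield_numeral[OF F] subfield_power[OF F])
        finally show False using kF by contradiction
      qed
    qed
    then show False using PJ ab by simp
  qed
qed

text \<open>
  A multiquadratic field is the compositum of its quadratic subfields, so products of local
  spanning pairs span it.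
\<close>

lemma field_gen_subset_span_products:
  fixes r :: "'a \<Rightarrow> complex" and b :: "'a \<Rightarrow> nat \<Rightarrow> complex"
  assumes "finite I"
    and "\<And>i. i \<in> I \<Longrightarrow> r i ^ 2 \<in> \<rat>"
    and "\<And>i. i \<in> I \<Longrightarrow> {1, r i} \<subseteq> rat_vs.span {b i 0, b i 1}"
  shows "field_gen (r ` I) \<subseteq> rat_vs.span ((\<lambda>s. \<Prod>i\<in>I. b i (s i)) ` (I \<rightarrow>\<^sub>E {0, 1}))"
  using assms
proof (induction I rule: finite_induct)
  case empty
  have "x \<in> rat_vs.span {1}" if "x \<in> \<rat>" for x
    using that rat_vs.span_scale[OF rat_vs.span_base[of 1 "{1}"]] by (auto elim!: Rats_cases)
  then show ?case by (simp add: field_gen_empty image_def) blast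
next
  case (insert k I)
  let ?E = "\<lambda>I. rat_vs.span ((\<lambda>s. \<Prod>i\<in>I. b i (s i)) ` (I \<rightarrow>\<^sub>E {0, 1}))"
  let ?F = "field_gen (r ` I)"
  note F = is_subfield_field_gen[of "r ` I"]
  have IH: "?F \<subseteq> ?E I" using insert by auto
  have mult_b: "a * b k j \<in> ?E (insert k I)" if "a \<in> ?E I" "j \<in> {0, 1}" for a j
    using that(1)
  proof (induction rule: rat_vs.span_induct_alt)
    case (step c x y)
    from step(1) obtain s where s: "s \<in> I \<rightarrow>\<^sub>E {0, 1}" "x = (\<Prod>i\<in>I. b i (s i))" by auto
    have "x * b k j = (\<Prod>i\<in>insert k I. b i ((s(k := j)) i))"
      using insert.hyps s by (auto simp: mult.commute intro!: prod.cong)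
    moreover have "s(k := j) \<in> insert k I \<rightarrow>\<^sub>E {0, 1}"
      using s that(2) by (intro PiE_fun_upd) auto
    ultimately have "x * b k j \<in> ?E (insert k I)"
      by (intro rat_vs.span_base image_eqI[of _ _ "s(k := j)"])
    then have "of_rat c * (x * b k j) + y * b k j \<in> ?E (insert k I)"
      using step by (intro rat_vs.span_add rat_vs.span_scale)
    then show ?case by (simp add: algebra_simps)
  qed (simp add: rat_vs.span_zero)
  have mult_span: "a * x \<in> ?E (insert k I)" if "a \<in> ?E I" "x \<in> rat_vs.span {b k 0, b k 1}" for a x
    using that(2)
  proof (induction rule: rat_vs.span_induct_alt)
    case (step c x y)
    then have "of_rat c * (a * x) + a * y \<in> ?E (insert k I)"
      using mult_b[OF that(1)] by (intro rat_vs.span_add rat_vs.span_scale) auto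
    then show ?case by (simp add: algebra_simps)
  qed (simp add: rat_vs.span_zero)
  show ?case
  proof
    fix x assume "x \<in> field_gen (r ` insert k I)"
    moreover have "r k ^ 2 \<in> ?F"
      using insert.prems subfield_Rats[OF F] by auto
    ultimately obtain a c where ac: "a \<in> ?F" "c \<in> ?F" "x = a + c * r k"
      using field_gen_insert_sqrt[of "r k" "r ` I"] by auto
    have "a * 1 \<in> ?E (insert k I)" "c * r k \<in> ?E (insert k I)"
      using ac IH insert.prems(2)[of k] by (blast intro: mult_span)+
    then show "x \<in> ?E (insert k I)"
      using ac rat_vs.span_add by fastforce
  qed
qed

section \<open>The automorphisms of a multiquadratic field\<close>

text \<open>
  Ring endomorphisms of a subfield that fix the rationals. Values outside \<open>K\<close> are left
  unconstrained, so that compositions of extensional automorphisms are covered, in particular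
  the empty one.
\<close>

locale subfield_endo =
  fixes K :: "complex set" and \<sigma> :: "complex \<Rightarrow> complex"
  assumes subfield: "is_subfield K"
    and maps: "x \<in> K \<Longrightarrow> \<sigma> x \<in> K"
    and add: "x \<in> K \<Longrightarrow> y \<in> K \<Longrightarrow> \<sigma> (x + y) = \<sigma> x + \<sigma> y"
    and mult: "x \<in> K \<Longrightarrow> y \<in> K \<Longrightarrow> \<sigma> (x * y) = \<sigma> x * \<sigma> y"
    and fixes_Rats: "x \<in> \<rat> \<Longrightarrow> \<sigma> x = x"
begin

lemma in_Rats: "x \<in> \<rat> \<Longrightarrow> x \<in> K"
  using subfield_Rats[OF subfield] by blast

lemma uminus: "x \<in> K \<Longrightarrow> \<sigma> (- x) = - \<sigma> x"
  using mult[of "- 1" x] in_Rats[of "- 1"] fixes_Rats[of "- 1"] by simp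

lemma diff: "x \<in> K \<Longrightarrow> y \<in> K \<Longrightarrow> \<sigma> (x - y) = \<sigma> x - \<sigma> y"
  using add[of x "- y"] uminus[of y] subfield_uminus[OF subfield, of y] by simp

lemma rat_mult: "c \<in> \<rat> \<Longrightarrow> x \<in> K \<Longrightarrow> \<sigma> (c * x) = c * \<sigma> x"
  by (simp add: mult in_Rats fixes_Rats)

lemma inverse: "x \<in> K \<Longrightarrow> \<sigma> (inverse x) = inverse (\<sigma> x)"
proof (cases "x = 0")
  case False
  assume x: "x \<in> K"
  have "\<sigma> x * \<sigma> (inverse x) = \<sigma> (x * inverse x)"
    using x by (simp add: mult subfield_inverse[OF subfield])
  also have "\<dots> = 1"
    using False by (simp add: fixes_Rats)
  finally show ?thesis
    by (metis inverse_unique)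
qed (simp add: fixes_Rats)

lemma power: "x \<in> K \<Longrightarrow> \<sigma> (x ^ n) = \<sigma> x ^ n"
  by (induction n) (auto simp: fixes_Rats mult subfield_power[OF subfield])

lemma sum: "(\<And>i. i \<in> A \<Longrightarrow> f i \<in> K) \<Longrightarrow> \<sigma> (\<Sum>i\<in>A. f i) = (\<Sum>i\<in>A. \<sigma> (f i))"
  by (induction A rule: infinite_finite_induct)
    (auto simp: fixes_Rats add subfield_sum[OF subfield])

lemma prod: "(\<And>i. i \<in> A \<Longrightarrow> f i \<in> K) \<Longrightarrow> \<sigma> (\<Prod>i\<in>A. f i) = (\<Prod>i\<in>A. \<sigma> (f i))"
  by (induction A rule: infinite_finite_induct)
    (auto simp: fixes_Rats mult subfield_prod[OF subfield])

lemma poly_of_int: "x \<in> K \<Longrightarrow> poly (of_int_poly p) x \<in> K \<and>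
    \<sigma> (poly (of_int_poly p) x) = poly (of_int_poly p) (\<sigma> x)"
proof (induction p)
  case (pCons a p)
  then show ?case
    by (auto simp: add mult fixes_Rats subfield_of_int[OF subfield]
        subfield_add[OF subfield] subfield_mult[OF subfield])
qed (simp add: fixes_Rats subfield_0[OF subfield])

text \<open>
  The image is a root of the same monic integer polynomial.
\<close>

lemma algebraic_int:
  assumes "x \<in> K" "algebraic_int x"
  shows "algebraic_int (\<sigma> x)"
proof -
  obtain p where p: "poly (of_int_poly p) x = 0" "lead_coeff p = 1"
    using assms(2) unfolding algebraic_int_altdef_ipoly by blast
  then have "poly (of_int_poly p) (\<sigma> x) = 0"
    using poly_of_int[OF assms(1), of p] fixes_Rats[of 0] by simp
  with p(2) show ?thesis
    unfolding algebraic_int_altdef_ipoly by blast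
qed

text \<open>
  The elements on which two endomorphisms agree form a subfield.
\<close>

lemma eq_on_field_gen:
  assumes K: "K = field_gen S" and \<rho>: "subfield_endo K \<rho>"
    and S: "\<And>x. x \<in> S \<Longrightarrow> \<sigma> x = \<rho> x" and x: "x \<in> K"
  shows "\<sigma> x = \<rho> x"
proof -
  interpret \<rho>: subfield_endo K \<rho> by (rule \<rho>)
  have "is_subfield {x \<in> K. \<sigma> x = \<rho> x}"
    unfolding is_subfield_def
    by (auto simp: fixes_Rats \<rho>.fixes_Rats diff \<rho>.diff mult \<rho>.mult inverse \<rho>.inverse
        intro: subfield_1 subfield_diff subfield_mult subfield_inverse subfield)
  moreover have "S \<subseteq> {x \<in> K. \<sigma> x = \<rho> x}"
    using S field_gen_superset[of S] K by auto
  ultimately show ?thesis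
    using field_gen_minimal[of S "{x \<in> K. \<sigma> x = \<rho> x}"] x K by auto
qed

end

lemma subfield_endo_Gal:
  assumes "is_subfield K" "\<sigma> \<in> Gal K"
  shows "subfield_endo K \<sigma>"
  using assms by unfold_locales (auto simp: Gal_def bij_betw_def)

lemma subfield_endo_id: "is_subfield K \<Longrightarrow> subfield_endo K id"
  by unfold_locales auto

lemma subfield_endo_comp:
  assumes "subfield_endo K \<sigma>" "subfield_endo K \<rho>"
  shows "subfield_endo K (\<sigma> \<circ> \<rho>)"
proof -
  interpret \<sigma>: subfield_endo K \<sigma> by (rule assms(1))
  interpret \<rho>: subfield_endo K \<rho> by (rule assms(2))
  show ?thesis
    by unfold_locales
      (auto simp: \<sigma>.subfield \<sigma>.maps \<rho>.maps \<sigma>.add \<rho>.add \<sigma>.mult \<rho>.mult \<sigma>.fixes_Rats \<rho>.fixes_Rats)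
qed

lemma subfield_endo_funpow:
  assumes "subfield_endo K \<sigma>"
  shows "subfield_endo K (\<sigma> ^^ n)"
proof (induction n)
  case 0
  have "\<sigma> ^^ 0 = id" by auto
  then show ?case
    using subfield_endo_id[OF subfield_endo.subfield[OF assms]] by metis
next
  case (Suc n)
  have "\<sigma> ^^ Suc n = \<sigma> \<circ> \<sigma> ^^ n" by auto
  then show ?case
    using subfield_endo_comp[OF assms Suc.IH] by metis
qed

text \<open>
  As \<open>w\<close> is not in \<open>F\<close>, the representation \<open>a + b w\<close> is unique and \<open>w \<mapsto> - w\<close> gives a well-defined
  involution.
\<close>

lemma Gal_adjoin_sqrt:
  assumes F: "is_subfield F" and w: "w ^ 2 \<in> F" "w \<notin> F"
  obtains \<sigma> where "\<sigma> \<in> Gal {a + b * w | a b. a \<in> F \<and> b \<in> F}"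
    "\<And>a b. a \<in> F \<Longrightarrow> b \<in> F \<Longrightarrow> \<sigma> (a + b * w) = a - b * w"
proof -
  define G where "G = {a + b * w | a b. a \<in> F \<and> b \<in> F}"
  note sf = subfield_0[OF F] subfield_add[OF F] subfield_mult[OF F] subfield_diff[OF F]
    subfield_uminus[OF F]
  have GI: "a + b * w \<in> G" if "a \<in> F" "b \<in> F" for a b
    using that by (auto simp: G_def)
  have "\<forall>x\<in>G. \<exists>p. fst p \<in> F \<and> snd p \<in> F \<and> x = fst p + snd p * w"
    by (auto simp: G_def)
  then obtain f where f: "\<And>x. x \<in> G \<Longrightarrow> fst (f x) \<in> F \<and> snd (f x) \<in> F \<and> x = fst (f x) + snd (f x) * w"
    by metis
  define \<sigma> where "\<sigma> = restrict (\<lambda>x. fst (f x) - snd (f x) * w) G"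
  have uniq: "a = c \<and> b = e" if "a \<in> F" "b \<in> F" "c \<in> F" "e \<in> F" "a + b * w = c + e * w" for a b c e
  proof -
    have eq: "(b - e) * w = c - a" using that by (simp add: algebra_simps)
    have "b = e"
    proof (rule ccontr)
      assume "b \<noteq> e"
      then have "w = (c - a) / (b - e)" using eq by (simp add: field_simps)
      then show False using w(2) that by (auto intro!: subfield_divide[OF F] sf)
    qed
    then show ?thesis using eq by simp
  qed
  have \<sigma>: "\<sigma> (a + b * w) = a - b * w" if "a \<in> F" "b \<in> F" for a b
    using f[OF GI[OF that]] uniq[OF that, of "fst (f (a + b * w))" "snd (f (a + b * w))"] GI[OF that]
    by (auto simp: \<sigma>_def)
  have cases: thesis if "x \<in> G" "\<And>a b. a \<in> F \<Longrightarrow> b \<in> F \<Longrightarrow> x = a + b * w \<Longrightarrow> thesis" for x thesis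
    using that by (auto simp: G_def)
  have maps: "\<sigma> x \<in> G \<and> \<sigma> (\<sigma> x) = x" if "x \<in> G" for x
    using that
  proof (rule cases)
    fix a b assume ab: "a \<in> F" "b \<in> F" "x = a + b * w"
    then have eq: "\<sigma> x = a + (- b) * w" using \<sigma> by simp
    have "a + (- b) * w \<in> G" by (intro GI sf ab)
    moreover have "\<sigma> (a + (- b) * w) = a - (- b) * w" by (intro \<sigma> sf ab)
    ultimately show ?thesis unfolding eq using ab(3) by simp
  qed
  have "\<sigma> \<in> Gal G"
    unfolding Gal_def
  proof (intro CollectI conjI ballI)
    show "\<sigma> \<in> extensional G" by (simp add: \<sigma>_def)
    show "bij_betw \<sigma> G G"
      using maps by (intro bij_betw_byWitness[where f' = \<sigma>]) auto
  next
    fix x y assume "x \<in> G" "y \<in> G"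
    then obtain a b c e where ab: "a \<in> F" "b \<in> F" and x: "x = a + b * w"
      and ce: "c \<in> F" "e \<in> F" and y: "y = c + e * w"
      by (auto simp: G_def)
    have \<sigma>xy: "\<sigma> x = a - b * w" "\<sigma> y = c - e * w"
      unfolding x y by (intro \<sigma> ab ce)+
    have "x + y = (a + c) + (b + e) * w"
      unfolding x y by (simp add: algebra_simps)
    also have "\<sigma> \<dots> = (a + c) - (b + e) * w"
      by (intro \<sigma> sf ab ce)
    finally show "\<sigma> (x + y) = \<sigma> x + \<sigma> y"
      unfolding \<sigma>xy by (simp add: algebra_simps)
    have "x * y = (a * c + b * e * w ^ 2) + (a * e + b * c) * w"
      unfolding x y by (simp add: power2_eq_square algebra_simps)
    also have "\<sigma> \<dots> = (a * c + b * e * w ^ 2) - (a * e + b * c) * w"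
      by (intro \<sigma> sf ab ce w)
    finally show "\<sigma> (x * y) = \<sigma> x * \<sigma> y"
      unfolding \<sigma>xy by (simp add: power2_eq_square algebra_simps)
  next
    fix x :: complex assume "x \<in> \<rat>"
    then show "\<sigma> x = x"
      using \<sigma>[of x 0] subfield_Rats[OF F] by (auto simp: sf)
  qed
  then show ?thesis
    using that[OF _ \<sigma>] unfolding G_def by blast
qed

text \<open>
  Equivalent to \<open>[K : \<rat>] = 2\<^sup>t\<close>, in the form in which it can be checked for prime discriminants.
\<close>

locale independent_square_roots =
  fixes r :: "nat \<Rightarrow> complex" and t :: nat
  assumes square_Rats: "i \<in> {1..t} \<Longrightarrow> r i ^ 2 \<in> \<rat>"
    and prod_notin_Rats: "L \<subseteq> {1..t} \<Longrightarrow> L \<noteq> {} \<Longrightarrow> (\<Prod>i\<in>L. r i) \<notin> \<rat>"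
begin

abbreviation "K \<equiv> genus_field r t"

lemma K: "is_subfield K"
  unfolding genus_field_def by (rule is_subfield_field_gen)

lemma r_in_K: "i \<in> {1..t} \<Longrightarrow> r i \<in> K"
  unfolding genus_field_def using field_gen_superset by blast

lemma K_adjoin:
  assumes j: "j \<in> {1..t}"
  shows "K = {a + b * r j | a b. a \<in> field_gen (r ` ({1..t} - {j})) \<and> b \<in> field_gen (r ` ({1..t} - {j}))}"
proof -
  have "r ` {1..t} = insert (r j) (r ` ({1..t} - {j}))"
    using j by auto
  moreover have "r j ^ 2 \<in> field_gen (r ` ({1..t} - {j}))"
    using square_Rats[OF j] subfield_Rats[OF is_subfield_field_gen] by blast
  ultimately show ?thesis
    unfolding genus_field_def by (simp add: field_gen_insert_sqrt)
qed

lemma tau_Gal: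
  assumes j: "j \<in> {1..t}"
  shows "tau r t j \<in> Gal K"
    and "i \<in> {1..t} \<Longrightarrow> tau r t j (r i) = (if i = j then - r i else r i)"
proof -
  let ?F = "field_gen (r ` ({1..t} - {j}))"
  note F = is_subfield_field_gen[of "r ` ({1..t} - {j})"]
  have ins: "({1..t} - {j}) \<union> {j} = {1..t}"
    using j by blast
  have "(\<Prod>i\<in>{j}. r i) \<notin> ?F"
  proof (rule prod_sqrt_notin_field_gen, unfold ins)
    show "r i ^ 2 \<in> \<rat>" if "i \<in> {1..t}" for i
      by (rule square_Rats[OF that])
    show "(\<Prod>i\<in>L. r i) \<notin> \<rat>" if "L \<subseteq> {1..t}" "L \<noteq> {}" for L
      by (rule prod_notin_Rats[OF that])
  qed simp_all
  then have notin: "r j \<notin> ?F" by simp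
  have sq: "r j ^ 2 \<in> ?F"
    using square_Rats[OF j] subfield_Rats[OF F] by blast
  obtain \<sigma> where "\<sigma> \<in> Gal {a + b * r j | a b. a \<in> ?F \<and> b \<in> ?F}"
      and \<sigma>: "\<And>a b. a \<in> ?F \<Longrightarrow> b \<in> ?F \<Longrightarrow> \<sigma> (a + b * r j) = a - b * r j"
    by (rule Gal_adjoin_sqrt[OF F sq notin]) (blast intro: that)
  then have \<sigma>_Gal: "\<sigma> \<in> Gal K"
    unfolding K_adjoin[OF j] by blast
  have \<sigma>r: "\<sigma> (r i) = (if i = j then - r i else r i)" if "i \<in> {1..t}" for i
  proof (cases "i = j")
    case True
    have "\<sigma> (0 + 1 * r j) = 0 - 1 * r j"
      by (intro \<sigma> subfield_0[OF F] subfield_1[OF F])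
    then show ?thesis using True by simp
  next
    case False
    then have "r i \<in> r ` ({1..t} - {j})" using that by blast
    then have "r i \<in> ?F" by (rule subsetD[OF field_gen_superset])
    then have "\<sigma> (r i + 0 * r j) = r i - 0 * r j"
      by (intro \<sigma> subfield_0[OF F])
    then show ?thesis using False by simp
  qed
  let ?P = "\<lambda>\<sigma>. \<sigma> \<in> Gal K \<and> (\<forall>i\<in>{1..t}. \<sigma> (r i) = (if i = j then - r i else r i))"
  have "\<exists>!\<sigma>. ?P \<sigma>"
  proof (rule ex1I[of _ \<sigma>])
    show "?P \<sigma>" using \<sigma>_Gal \<sigma>r by blast
    fix \<rho> assume \<rho>: "?P \<rho>"
    have "\<rho> x = \<sigma> x" if "x \<in> K" for x
    proof (rule subfield_endo.eq_on_field_gen[OF _ genus_field_def _ _ that])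
      show "subfield_endo K \<rho>" "subfield_endo K \<sigma>"
        using \<rho> \<sigma>_Gal K by (auto intro: subfield_endo_Gal)
      show "\<rho> x = \<sigma> x" if "x \<in> r ` {1..t}" for x
        using that \<rho> \<sigma>r by auto
    qed
    then show "\<rho> = \<sigma>"
      using \<rho> \<sigma>_Gal by (intro extensionalityI[of _ K]) (auto simp: Gal_def)
  qed
  then have "?P (tau r t j)"
    unfolding tau_def by (rule theI')
  then show "tau r t j \<in> Gal K"
    and "i \<in> {1..t} \<Longrightarrow> tau r t j (r i) = (if i = j then - r i else r i)"
    by blast+
qed

text \<open>
  The composition is treated for an arbitrary list of distinct indices to allow induction. Each
  \<open>\<tau>\<^sub>j\<close> acts on a root \<open>r\<^sub>i\<close> by a sign, which the endomorphisms applied later leave alone.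
\<close>

lemma foldr_tau:
  assumes "distinct js" "set js \<subseteq> {1..t}"
  shows "subfield_endo K (foldr (\<circ>) (map (\<lambda>j. tau r t j ^^ \<mu> j) js) id) \<and>
    (\<forall>i\<in>{1..t}. foldr (\<circ>) (map (\<lambda>j. tau r t j ^^ \<mu> j) js) id (r i) =
      (if i \<in> set js then (- 1) ^ \<mu> i * r i else r i))"
  using assms
proof (induction js)
  case Nil
  show ?case
    using subfield_endo_id[OF K] by (simp add: id_def)
next
  case (Cons j js)
  let ?\<rho> = "foldr (\<circ>) (map (\<lambda>j. tau r t j ^^ \<mu> j) js) id"
  have j: "j \<in> {1..t}" "j \<notin> set js" using Cons.prems by auto
  interpret \<tau>: subfield_endo K "tau r t j"
    by (rule subfield_endo_Gal[OF K tau_Gal(1)[OF j(1)]])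
  have pow: "(tau r t j ^^ n) (r i) = (if i = j then (- 1) ^ n * r i else r i)" if "i \<in> {1..t}" for i n
    using that by (induction n)
      (auto simp: tau_Gal(2)[OF j(1)] \<tau>.rat_mult[OF _ r_in_K])
  interpret \<tau>\<mu>: subfield_endo K "tau r t j ^^ \<mu> j"
    by (rule subfield_endo_funpow) unfold_locales
  have IH: "subfield_endo K ?\<rho>"
    "\<And>i. i \<in> {1..t} \<Longrightarrow> ?\<rho> (r i) = (if i \<in> set js then (- 1) ^ \<mu> i * r i else r i)"
    using Cons.IH Cons.prems unfolding distinct.simps list.set insert_subset by blast+
  show ?case
  proof (intro conjI ballI)
    show "subfield_endo K (foldr (\<circ>) (map (\<lambda>j. tau r t j ^^ \<mu> j) (j # js)) id)"
      using subfield_endo_comp[OF \<tau>\<mu>.subfield_endo_axioms IH(1)] by simp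
    fix i assume i: "i \<in> {1..t}"
    show "foldr (\<circ>) (map (\<lambda>j. tau r t j ^^ \<mu> j) (j # js)) id (r i) =
      (if i \<in> set (j # js) then (- 1) ^ \<mu> i * r i else r i)"
      using IH(2)[OF i] j(2) pow[OF i, of "\<mu> j"]
      by (cases "i = j") (auto simp: \<tau>\<mu>.rat_mult[OF _ r_in_K[OF i]])
  qed
qed

lemma subfield_endo_tau_vec: "subfield_endo K (tau_vec r t \<mu>)"
  and tau_vec_r:
    "i \<in> {1..t} \<Longrightarrow> tau_vec r t \<mu> (r i) = (if i < t then (- 1) ^ \<mu> i * r i else r i)"
proof -
  have "set [1..<t] \<subseteq> {1..t}" by auto
  from foldr_tau[OF distinct_upt this, of \<mu>]
  show "subfield_endo K (tau_vec r t \<mu>)"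
    and "i \<in> {1..t} \<Longrightarrow> tau_vec r t \<mu> (r i) = (if i < t then (- 1) ^ \<mu> i * r i else r i)"
    by (auto simp: tau_vec_def)
qed

end

section \<open>The two families as traces of products of local factors\<close>

text \<open>
  A signed sum over vectors \<open>\<mu>\<close> of products whose \<open>i\<close>-th term depends on \<open>\<mu>\<^sub>i\<close> only is the expansion of
  a product of sums.
\<close>

lemma alternating_sum_prod:
  fixes g :: "'a \<Rightarrow> nat \<Rightarrow> complex"
  assumes "finite I" "\<And>i. i \<in> I \<Longrightarrow> finite (J i)"
  shows "(\<Sum>\<mu>\<in>Pi\<^sub>E I J. (- 1) ^ (\<Sum>i\<in>I. \<mu> i) * (\<Prod>i\<in>I. g i (\<mu> i))) =
    (\<Prod>i\<in>I. \<Sum>j\<in>J i. (- 1) ^ j * g i j)"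
  using assms by (simp add: prod_sum_PiE power_sum prod.distrib)

text \<open>
  The \<open>i\<close>-th factor of \<open>beta\<close> as a polynomial in the square root: at \<open>r\<^sub>i\<close> it is \<open>\<surd>2\<^sup>a\<close> for
  \<open>i = 1\<close> and one of \<open>\<alpha>\<^sub>i\<close>, \<open>\<alpha>\<^sub>i'\<close> otherwise. The automorphisms and complex conjugation then act by
  changing the sign of the argument.
\<close>

definition factor :: "nat \<Rightarrow> nat \<Rightarrow> complex \<Rightarrow> complex" where
  "factor i a x = (if i = 1 then (x / 2) ^ a else ((1 - x) / 2) ^ a * ((1 + x) / 2) ^ (1 - a))"

text \<open>
  The \<open>i\<close>-th factor of \<open>beta_star\<close>, likewise.
\<close>

definition dual_factor :: "nat \<Rightarrow> nat \<Rightarrow> complex \<Rightarrow> complex" where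
  "dual_factor i a x =
     (if i = 1 then (x / 2) ^ (1 - a) else (- ((1 - x) / 2)) ^ a * ((1 + x) / 2) ^ (1 - a))"

text \<open>
  The local duality. With \<open>\<alpha> = (1 + x) / 2\<close> and \<open>\<alpha>' = (1 - x) / 2\<close>, the left-hand side is
  \<open>\<alpha>\<^sup>2 - \<alpha>'\<^sup>2 = x\<close> in the diagonal cases, for \<open>a = 1\<close> thanks to the sign in the dual factor. In
  the other two cases the product is symmetric in \<open>\<alpha>\<close> and \<open>\<alpha>'\<close>.
\<close>

lemma factor_alternating:
  assumes "a \<in> {0, 1}" "b \<in> {0, 1}" "i \<noteq> 1"
  shows "factor i a x * dual_factor i b x - factor i a (- x) * dual_factor i b (- x) =
    (if a = b then x else 0)"
  using assms by (auto simp: factor_def dual_factor_def field_simps power2_eq_square)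

lemma cnj_factor: "cnj (factor i a x) = factor i a (cnj x)"
  by (simp add: factor_def)

lemma cnj_dual_factor: "cnj (dual_factor i a x) = dual_factor i a (cnj x)"
  by (simp add: dual_factor_def)

lemma factor_in_subfield: "is_subfield K \<Longrightarrow> x \<in> K \<Longrightarrow> factor i a x \<in> K"
  unfolding factor_def
  by (auto intro!: subfield_mult subfield_power subfield_divide subfield_diff subfield_add
      subfield_1 subfield_numeral)

lemma dual_factor_in_subfield: "is_subfield K \<Longrightarrow> x \<in> K \<Longrightarrow> dual_factor i a x \<in> K"
  unfolding dual_factor_def
  by (auto intro!: subfield_mult subfield_power subfield_divide subfield_diff subfield_add
      subfield_1 subfield_numeral subfield_uminus simp del: minus_divide_left)

context subfield_endo
begin

lemma divide_2: "x \<in> K \<Longrightarrow> \<sigma> (x / 2) = \<sigma> x / 2"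
  using rat_mult[of "1/2" x] by simp

lemmas closed = subfield_1[OF subfield] subfield_diff[OF subfield] subfield_add[OF subfield]
  subfield_mult[OF subfield] subfield_power[OF subfield] subfield_uminus[OF subfield]
  subfield_divide[OF subfield _ subfield_numeral[OF subfield]]

lemma factor: "x \<in> K \<Longrightarrow> \<sigma> (factor i a x) = factor i a (\<sigma> x)"
  by (simp add: factor_def mult power divide_2 add diff fixes_Rats closed)

lemma dual_factor: "x \<in> K \<Longrightarrow> \<sigma> (dual_factor i a x) = dual_factor i a (\<sigma> x)"
  unfolding dual_factor_def
  by (simp add: mult power divide_2 add diff uminus fixes_Rats closed del: minus_divide_left)

end

text \<open>
  The situation of the theorem, with the discriminants replaced by what is used about their square
  roots. The hypothesis \<open>cnj_prod_r\<close> says that \<open>\<surd>d\<close> is imaginary, and \<open>m\<close> is the odd part of \<open>d\<close>.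
\<close>

locale genus_field_sqrt2 = independent_square_roots +
  fixes u :: nat and m :: int
  assumes u: "1 \<le> u" "u < t"
    and r1: "r 1 = 2 * complex_of_real (sqrt 2)"
    and cnj_r_pos: "i \<in> {1..u} \<Longrightarrow> cnj (r i) = r i"
    and cnj_r_neg: "i \<in> {u<..t} \<Longrightarrow> cnj (r i) = - r i"
    and cnj_prod_r: "cnj (\<Prod>i\<in>{1..t}. r i) = - (\<Prod>i\<in>{1..t}. r i)"
    and alpha_int: "i \<in> {2..t} \<Longrightarrow> algebraic_int (alpha r i)"
    and m: "(\<Prod>i\<in>{2..t}. r i) ^ 2 = of_int m" "odd m" "squarefree m"
begin

lemma r_nonzero: "i \<in> {1..t} \<Longrightarrow> r i \<noteq> 0"
  using prod_notin_Rats[of "{i}"] by auto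

lemma cnj_r_in_K: "i \<in> {1..t} \<Longrightarrow> cnj (r i) \<in> K"
  using cnj_r_pos[of i] cnj_r_neg[of i] r_in_K[of i] subfield_uminus[OF K, of "r i"]
  by (cases "i \<le> u") auto

text \<open>
  The sign by which complex conjugation acts on the \<open>i\<close>-th root.
\<close>

definition \<epsilon> :: "nat \<Rightarrow> complex" where "\<epsilon> i = (if i \<le> u then 1 else - 1)"

lemma cnj_r: "i \<in> {1..t} \<Longrightarrow> cnj (r i) = \<epsilon> i * r i"
  using cnj_r_pos[of i] cnj_r_neg[of i] by (auto simp: \<epsilon>_def)

text \<open>
  Since \<open>\<surd>d\<close> is imaginary, the product of all signs is \<open>-1\<close>, and the sign at \<open>t\<close> is \<open>-1\<close> already.
\<close>

lemma prod_\<epsilon>: "(\<Prod>i\<in>{1..t-1}. \<epsilon> i) = 1"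
proof -
  have t: "{1..t} = insert t {1..t-1}" using u by auto
  have "(\<Prod>i\<in>{1..t}. \<epsilon> i) * (\<Prod>i\<in>{1..t}. r i) = cnj (\<Prod>i\<in>{1..t}. r i)"
    by (simp add: prod.distrib[symmetric] cnj_r)
  also have "\<dots> = - 1 * (\<Prod>i\<in>{1..t}. r i)"
    unfolding cnj_prod_r by simp
  finally have "(\<Prod>i\<in>{1..t}. \<epsilon> i) = - 1"
    using r_nonzero by (subst (asm) mult_right_cancel) auto
  moreover have "(\<Prod>i\<in>{1..t}. \<epsilon> i) = \<epsilon> t * (\<Prod>i\<in>{1..t-1}. \<epsilon> i)"
    unfolding t by (rule prod.insert) (use u in auto)
  ultimately show ?thesis using u by (simp add: \<epsilon>_def)
qed

definition monomial :: "(nat \<Rightarrow> nat \<Rightarrow> complex \<Rightarrow> complex) \<Rightarrow> (nat \<Rightarrow> nat) \<Rightarrow> (nat \<Rightarrow> complex) \<Rightarrow> complex"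
  where "monomial f s x = (\<Prod>i\<in>{1..t-1}. f i (s i) (x i))"

lemma split_prod:
  fixes g :: "nat \<Rightarrow> complex"
  shows "(\<Prod>i\<in>{1..t-1}. g i) = g 1 * (\<Prod>i\<in>{2..u}. g i) * (\<Prod>i\<in>{u+1..t-1}. g i)"
proof -
  have "{1..t-1} = insert 1 ({2..u} \<union> {u+1..t-1})" "1 \<notin> {2..u} \<union> {u+1..t-1}"
    "{2..u} \<inter> {u+1..t-1} = {}"
    using u by auto
  then show ?thesis
    by (simp only: prod.insert prod.union_disjoint finite_Un finite_atLeastAtMost mult.assoc simp_thms)
qed

lemma sqrt2: "complex_of_real (sqrt 2) = r 1 / 2"
  using r1 by simp

lemma beta_eq:
  "beta r u t s = monomial factor s r * alpha r t + monomial factor s (\<lambda>i. cnj (r i)) * alpha' r t"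
proof -
  have "(\<Prod>i\<in>{2..u}. factor i (s i) (cnj (r i))) = (\<Prod>i\<in>{2..u}. factor i (s i) (r i))"
    by (rule prod.cong) (auto simp: cnj_r_pos)
  moreover have "(\<Prod>i\<in>{2..u}. factor i (s i) (r i)) =
      (\<Prod>i\<in>{2..u}. alpha' r i ^ s i * alpha r i ^ (1 - s i))"
    by (rule prod.cong) (auto simp: factor_def alpha_def alpha'_def)
  moreover have "(\<Prod>i\<in>{u+1..t-1}. factor i (s i) (r i)) =
      (\<Prod>i\<in>{u+1..t-1}. alpha' r i ^ s i * alpha r i ^ (1 - s i))"
    by (rule prod.cong) (use u in \<open>auto simp: factor_def alpha_def alpha'_def\<close>)
  moreover have "(\<Prod>i\<in>{u+1..t-1}. factor i (s i) (cnj (r i))) =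
      (\<Prod>i\<in>{u+1..t-1}. alpha' r i ^ (1 - s i) * alpha r i ^ s i)"
    by (rule prod.cong) (use u in \<open>auto simp: cnj_r_neg factor_def alpha_def alpha'_def\<close>)
  moreover have "factor 1 (s 1) (r 1) = complex_of_real (sqrt 2) ^ s 1"
    "factor 1 (s 1) (cnj (r 1)) = complex_of_real (sqrt 2) ^ s 1"
    using u by (simp_all add: factor_def sqrt2 cnj_r_pos)
  ultimately show ?thesis
    unfolding beta_def monomial_def split_prod by (simp only:) (simp add: algebra_simps)
qed

lemma beta_star_eq:
  "beta_star r u t s = monomial dual_factor s r * alpha r t - monomial dual_factor s (\<lambda>i. cnj (r i)) * alpha' r t"
proof -
  have "(\<Prod>i\<in>{2..u}. dual_factor i (s i) (cnj (r i))) = (\<Prod>i\<in>{2..u}. dual_factor i (s i) (r i))"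
    by (rule prod.cong) (auto simp: cnj_r_pos)
  moreover have "(\<Prod>i\<in>{2..u}. dual_factor i (s i) (r i)) =
      (\<Prod>i\<in>{2..u}. (- alpha' r i) ^ s i * alpha r i ^ (1 - s i))"
    by (rule prod.cong) (auto simp: dual_factor_def alpha_def alpha'_def)
  moreover have "(\<Prod>i\<in>{u+1..t-1}. dual_factor i (s i) (r i)) =
      (\<Prod>i\<in>{u+1..t-1}. (- alpha' r i) ^ s i * alpha r i ^ (1 - s i))"
    by (rule prod.cong) (use u in \<open>auto simp: dual_factor_def alpha_def alpha'_def\<close>)
  moreover have "(\<Prod>i\<in>{u+1..t-1}. dual_factor i (s i) (cnj (r i))) =
      (\<Prod>i\<in>{u+1..t-1}. alpha' r i ^ (1 - s i) * (- alpha r i) ^ s i)"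
    by (rule prod.cong) (use u in \<open>auto simp: cnj_r_neg dual_factor_def alpha_def alpha'_def\<close>)
  moreover have "dual_factor 1 (s 1) (r 1) = complex_of_real (sqrt 2) ^ (1 - s 1)"
    "dual_factor 1 (s 1) (cnj (r 1)) = complex_of_real (sqrt 2) ^ (1 - s 1)"
    using u by (simp_all add: dual_factor_def sqrt2 cnj_r_pos)
  ultimately show ?thesis
    unfolding beta_star_def monomial_def split_prod by (simp only:) (simp add: algebra_simps)
qed

section \<open>Duality of the two families\<close>

text \<open>
  The parameter \<open>J\<close> is the range of the coordinate at the prime 2: with \<open>{0, 1}\<close> all automorphisms
  \<open>\<tau>\<^sub>\<mu>\<close> occur, with \<open>{0}\<close> those that fix \<open>\<surd>2\<close>.
\<close>

definition indices :: "nat set \<Rightarrow> (nat \<Rightarrow> nat) set" where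
  "indices J = Pi\<^sub>E {1..t-1} (\<lambda>i. if i = 1 then J else {0, 1})"

definition alternating :: "nat set \<Rightarrow> complex \<Rightarrow> complex" where
  "alternating J x = (\<Sum>\<mu>\<in>indices J. (- 1) ^ (\<Sum>i\<in>{1..t-1}. \<mu> i) * tau_vec r t \<mu> x)"

lemma indices_bits: "indices {0, 1} = bit_vecs (t - 1)"
  unfolding indices_def bit_vecs_def by (simp only: if_cancel)

lemma alternating_add: "x \<in> K \<Longrightarrow> y \<in> K \<Longrightarrow> alternating J (x + y) = alternating J x + alternating J y"
  unfolding alternating_def
  by (simp add: subfield_endo.add[OF subfield_endo_tau_vec] distrib_left sum.distrib)

lemma alternating_diff: "x \<in> K \<Longrightarrow> y \<in> K \<Longrightarrow> alternating J (x - y) = alternating J x - alternating J y"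
  unfolding alternating_def
  by (simp add: subfield_endo.diff[OF subfield_endo_tau_vec] right_diff_distrib sum_subtractf)

lemma alternating_rat_sum:
  assumes "\<And>i. i \<in> A \<Longrightarrow> f i \<in> K"
  shows "alternating J (\<Sum>i\<in>A. of_rat (c i) * f i) = (\<Sum>i\<in>A. of_rat (c i) * alternating J (f i))"
proof -
  have "tau_vec r t \<mu> (\<Sum>i\<in>A. of_rat (c i) * f i) = (\<Sum>i\<in>A. of_rat (c i) * tau_vec r t \<mu> (f i))" for \<mu>
  proof -
    interpret \<sigma>: subfield_endo K "tau_vec r t \<mu>" by (rule subfield_endo_tau_vec)
    show ?thesis
      using assms by (subst \<sigma>.sum) (auto simp: \<sigma>.rat_mult intro!: subfield_mult[OF K \<sigma>.in_Rats[OF Rats_of_rat]])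
  qed
  then show ?thesis
    unfolding alternating_def
    by (simp add: sum_distrib_left sum.swap[of _ "indices J"] mult.left_commute)
qed

lemma alternating_algebraic_int:
  "x \<in> K \<Longrightarrow> algebraic_int x \<Longrightarrow> algebraic_int (alternating J x)"
  unfolding alternating_def
  by (auto intro!: algebraic_int_sum algebraic_int_times algebraic_int_power
      subfield_endo.algebraic_int[OF subfield_endo_tau_vec])

text \<open>
  The factors \<open>x\<^sub>i\<close> and \<open>y\<^sub>i\<close> stand for the signs of complex conjugation, so that the four terms of
  \<open>beta * beta_star\<close> are all instances.
\<close>

lemma alternating_monomials:
  fixes x y :: "nat \<Rightarrow> complex"
  assumes J: "finite J" and xy: "\<And>i. i \<in> {1..t-1} \<Longrightarrow> x i \<in> \<rat>" "\<And>i. i \<in> {1..t-1} \<Longrightarrow> y i \<in> \<rat>"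
    and z: "z \<in> K" "\<And>\<mu>. tau_vec r t \<mu> z = z"
  shows "alternating J (monomial factor \<eta> (\<lambda>i. x i * r i) * monomial dual_factor \<nu> (\<lambda>i. y i * r i) * z) =
    (\<Prod>i\<in>{1..t-1}. \<Sum>j\<in>(if i = 1 then J else {0, 1}). (- 1) ^ j *
      (factor i (\<eta> i) ((- 1) ^ j * (x i * r i)) * dual_factor i (\<nu> i) ((- 1) ^ j * (y i * r i)))) * z"
proof -
  have rK: "x i * r i \<in> K" "y i * r i \<in> K" if "i \<in> {1..t-1}" for i
    using that xy[OF that] r_in_K[of i] subfield_Rats[OF K] by (auto intro!: subfield_mult[OF K])
  have "tau_vec r t \<mu> (monomial factor \<eta> (\<lambda>i. x i * r i) * monomial dual_factor \<nu> (\<lambda>i. y i * r i) * z) =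
    (\<Prod>i\<in>{1..t-1}. factor i (\<eta> i) ((- 1) ^ \<mu> i * (x i * r i)) *
       dual_factor i (\<nu> i) ((- 1) ^ \<mu> i * (y i * r i))) * z" for \<mu>
  proof -
    interpret \<sigma>: subfield_endo K "tau_vec r t \<mu>" by (rule subfield_endo_tau_vec)
    have *: "tau_vec r t \<mu> (c * r i) = (- 1) ^ \<mu> i * (c * r i)" if "c \<in> \<rat>" "i \<in> {1..t-1}" for c i
      using that r_in_K[of i] by (auto simp: \<sigma>.rat_mult tau_vec_r)
    have "tau_vec r t \<mu> (monomial factor \<eta> (\<lambda>i. x i * r i)) =
        (\<Prod>i\<in>{1..t-1}. factor i (\<eta> i) ((- 1) ^ \<mu> i * (x i * r i)))"
      unfolding monomial_def
      by (subst \<sigma>.prod) (auto intro!: prod.cong factor_in_subfield K rK simp: \<sigma>.factor rK * xy)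
    moreover have "tau_vec r t \<mu> (monomial dual_factor \<nu> (\<lambda>i. y i * r i)) =
        (\<Prod>i\<in>{1..t-1}. dual_factor i (\<nu> i) ((- 1) ^ \<mu> i * (y i * r i)))"
      unfolding monomial_def
      by (subst \<sigma>.prod) (auto intro!: prod.cong dual_factor_in_subfield K rK simp: \<sigma>.dual_factor rK * xy)
    moreover have "monomial factor \<eta> (\<lambda>i. x i * r i) \<in> K" "monomial dual_factor \<nu> (\<lambda>i. y i * r i) \<in> K"
      unfolding monomial_def
      by (auto intro!: subfield_prod[OF K] factor_in_subfield dual_factor_in_subfield K rK)
    ultimately show ?thesis
      using z by (simp add: \<sigma>.mult subfield_mult[OF K] prod.distrib)
  qed
  then show ?thesis
    unfolding alternating_def indices_def
    by (subst alternating_sum_prod[symmetric]) (use J in \<open>auto simp: sum_distrib_right mult.assoc\<close>)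
qed

text \<open>
  The duality. The local sums \<open>H\<close> are odd for \<open>i > 1\<close>, and the total sign \<open>\<Prod>\<epsilon>\<^sub>i\<close> is 1, so
  \<open>S x y\<close> does not change when both arguments are multiplied by \<open>\<epsilon>\<close>. Hence the two mixed terms of
  the product cancel and the two pure ones have the common factor \<open>S 1 1\<close>.
\<close>

lemma alternating_beta_beta_star:
  assumes J: "finite J" and bits: "\<And>i. i \<in> {1..t-1} \<Longrightarrow> \<eta> i \<in> {0, 1} \<and> \<nu> i \<in> {0, 1}"
  shows "alternating J (beta r u t \<eta> * beta_star r u t \<nu>) =
    (\<Sum>j\<in>J. (- 1) ^ j * ((- 1) ^ j * complex_of_real (sqrt 2)) ^ (\<eta> 1 + (1 - \<nu> 1))) *
    (if \<forall>i\<in>{2..t-1}. \<eta> i = \<nu> i then \<Prod>i\<in>{2..t}. r i else 0)"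
proof -
  let ?\<alpha> = "alpha r t" and ?\<alpha>' = "alpha' r t"
  define H where "H i x y = (\<Sum>j\<in>(if i = 1 then J else {0, 1}). (- 1) ^ j *
      (factor i (\<eta> i) ((- 1) ^ j * (x * r i)) * dual_factor i (\<nu> i) ((- 1) ^ j * (y * r i))))"
    for i and x y :: complex
  define S where "S x y = (\<Prod>i\<in>{1..t-1}. H i (x i) (y i))" for x y
  define B where "B x = monomial factor \<eta> (\<lambda>i. x i * r i)" for x
  define B' where "B' x = monomial dual_factor \<nu> (\<lambda>i. x i * r i)" for x
  have rt: "r t \<in> K" "tau_vec r t \<mu> (r t) = r t" for \<mu>
    using u by (auto intro: r_in_K simp: tau_vec_r)
  have \<alpha>: "?\<alpha> \<in> K" "?\<alpha>' \<in> K"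
    unfolding alpha_def alpha'_def using rt
    by (auto intro!: subfield_divide[OF K] subfield_add[OF K] subfield_diff[OF K] subfield_1[OF K] subfield_numeral[OF K])
  have \<tau>\<alpha>: "tau_vec r t \<mu> ?\<alpha> = ?\<alpha>" "tau_vec r t \<mu> ?\<alpha>' = ?\<alpha>'" for \<mu>
  proof -
    interpret \<sigma>: subfield_endo K "tau_vec r t \<mu>" by (rule subfield_endo_tau_vec)
    show "tau_vec r t \<mu> ?\<alpha> = ?\<alpha>" "tau_vec r t \<mu> ?\<alpha>' = ?\<alpha>'"
      unfolding alpha_def alpha'_def using rt by (simp_all add: \<sigma>.divide_2 \<sigma>.add \<sigma>.diff \<sigma>.fixes_Rats \<sigma>.closed)
  qed
  let ?one = "\<lambda>_ :: nat. 1 :: complex"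
  have \<epsilon>_Rats: "\<epsilon> i \<in> \<rat>" for i by (simp add: \<epsilon>_def)
  have B_cnj: "monomial factor \<eta> (\<lambda>i. cnj (r i)) = B \<epsilon>" "monomial dual_factor \<nu> (\<lambda>i. cnj (r i)) = B' \<epsilon>"
    "monomial factor \<eta> r = B ?one" "monomial dual_factor \<nu> r = B' ?one"
    unfolding B_def B'_def monomial_def by (auto intro!: prod.cong simp: cnj_r)
  have alt: "alternating J (B x * B' y * z) = S x y * z"
    if "x \<in> {?one, \<epsilon>}" "y \<in> {?one, \<epsilon>}" "z \<in> {?\<alpha> * ?\<alpha>, ?\<alpha> * ?\<alpha>', ?\<alpha>' * ?\<alpha>'}" for x y z
    unfolding B_def B'_def S_def H_def
  proof (rule alternating_monomials[OF J])
    show "z \<in> K" using that(3) \<alpha> by (auto intro: subfield_mult[OF K])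
    show "tau_vec r t \<mu> z = z" for \<mu>
      using that(3) \<alpha> \<tau>\<alpha> by (auto simp: subfield_endo.mult[OF subfield_endo_tau_vec])
  qed (use that \<epsilon>_Rats in auto)
  have BK: "B x * B' y * z \<in> K"
    if "x \<in> {?one, \<epsilon>}" "y \<in> {?one, \<epsilon>}" "z \<in> {?\<alpha> * ?\<alpha>, ?\<alpha> * ?\<alpha>', ?\<alpha>' * ?\<alpha>'}" for x y z
  proof -
    have xr: "x i * r i \<in> K" "y i * r i \<in> K" if "i \<in> {1..t-1}" for i
      using that \<open>x \<in> _\<close> \<open>y \<in> _\<close> r_in_K[of i] subfield_Rats[OF K] \<epsilon>_Rats[of i]
      by (auto intro!: subfield_mult[OF K])
    show ?thesis
      unfolding B_def B'_def monomial_def using that(3) \<alpha>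
      by (auto intro!: subfield_mult[OF K] subfield_prod[OF K] factor_in_subfield dual_factor_in_subfield K xr)
  qed
  have H_odd: "H i (- x) (- y) = - H i x y" if "i \<noteq> 1" for i x y
    using that by (simp add: H_def)
  have scale: "H i (\<epsilon> i * x) (\<epsilon> i * y) = \<epsilon> i * H i x y" if "i \<in> {1..t-1}" for i x y
    using that u H_odd[of i x y] by (auto simp: \<epsilon>_def)
  have S_scale: "S (\<lambda>i. \<epsilon> i * x i) (\<lambda>i. \<epsilon> i * y i) = S x y" for x y
    using prod_\<epsilon> by (simp add: S_def scale prod.distrib)
  have \<epsilon>\<epsilon>: "\<epsilon> i * \<epsilon> i = 1" for i by (simp add: \<epsilon>_def)
  have S_eq: "S \<epsilon> \<epsilon> = S ?one ?one" "S \<epsilon> ?one = S ?one \<epsilon>"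
    using S_scale[of ?one ?one] S_scale[of ?one \<epsilon>] by (simp_all add: \<epsilon>\<epsilon>)
  have expand: "beta r u t \<eta> * beta_star r u t \<nu> =
      (B ?one * B' ?one * (?\<alpha> * ?\<alpha>) - B ?one * B' \<epsilon> * (?\<alpha> * ?\<alpha>')) +
      (B \<epsilon> * B' ?one * (?\<alpha> * ?\<alpha>') - B \<epsilon> * B' \<epsilon> * (?\<alpha>' * ?\<alpha>'))"
    unfolding beta_eq beta_star_eq B_cnj by (simp add: algebra_simps)
  have "alternating J (beta r u t \<eta> * beta_star r u t \<nu>) =
      (S ?one ?one * (?\<alpha> * ?\<alpha>) - S ?one \<epsilon> * (?\<alpha> * ?\<alpha>')) +
      (S \<epsilon> ?one * (?\<alpha> * ?\<alpha>') - S \<epsilon> \<epsilon> * (?\<alpha>' * ?\<alpha>'))"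
  proof -
    have K4: "B ?one * B' ?one * (?\<alpha> * ?\<alpha>) \<in> K" "B ?one * B' \<epsilon> * (?\<alpha> * ?\<alpha>') \<in> K"
      "B \<epsilon> * B' ?one * (?\<alpha> * ?\<alpha>') \<in> K" "B \<epsilon> * B' \<epsilon> * (?\<alpha>' * ?\<alpha>') \<in> K"
      by (rule BK; blast)+
    have alt4: "alternating J (B ?one * B' ?one * (?\<alpha> * ?\<alpha>)) = S ?one ?one * (?\<alpha> * ?\<alpha>)"
      "alternating J (B ?one * B' \<epsilon> * (?\<alpha> * ?\<alpha>')) = S ?one \<epsilon> * (?\<alpha> * ?\<alpha>')"
      "alternating J (B \<epsilon> * B' ?one * (?\<alpha> * ?\<alpha>')) = S \<epsilon> ?one * (?\<alpha> * ?\<alpha>')"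
      "alternating J (B \<epsilon> * B' \<epsilon> * (?\<alpha>' * ?\<alpha>')) = S \<epsilon> \<epsilon> * (?\<alpha>' * ?\<alpha>')"
      by (rule alt; blast)+
    show ?thesis
      by (simp only: expand alternating_add alternating_diff subfield_diff[OF K] K4 alt4)
  qed
  also have "\<dots> = S ?one ?one * (?\<alpha> * ?\<alpha> - ?\<alpha>' * ?\<alpha>')"
    unfolding S_eq by (simp add: algebra_simps)
  also have "\<dots> = S ?one ?one * r t"
    by (simp add: alpha_def alpha'_def field_simps)
  finally have total: "alternating J (beta r u t \<eta> * beta_star r u t \<nu>) = S ?one ?one * r t" .
  have S1: "S ?one ?one = H 1 1 1 * (\<Prod>i\<in>{2..t-1}. H i 1 1)"
  proof -
    have "{1..t-1} = insert 1 {2..t-1}" using u by auto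
    then show ?thesis unfolding S_def by (simp only: prod.insert finite_atLeastAtMost) simp
  qed
  have "(\<Prod>i\<in>{2..t-1}. H i 1 1) = (\<Prod>i\<in>{2..t-1}. if \<eta> i = \<nu> i then r i else 0)"
  proof (rule prod.cong)
    fix i assume i: "i \<in> {2..t-1}"
    then have "H i 1 1 = factor i (\<eta> i) (r i) * dual_factor i (\<nu> i) (r i) -
        factor i (\<eta> i) (- r i) * dual_factor i (\<nu> i) (- r i)"
      by (simp add: H_def)
    also have "\<dots> = (if \<eta> i = \<nu> i then r i else 0)"
      using i bits[of i] by (intro factor_alternating) auto
    finally show "H i 1 1 = (if \<eta> i = \<nu> i then r i else 0)" .
  qed simp
  also have "\<dots> = (if \<forall>i\<in>{2..t-1}. \<eta> i = \<nu> i then \<Prod>i\<in>{2..t-1}. r i else 0)"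
    by (auto intro!: prod.cong)
  finally have S2: "(\<Prod>i\<in>{2..t-1}. H i 1 1) =
    (if \<forall>i\<in>{2..t-1}. \<eta> i = \<nu> i then \<Prod>i\<in>{2..t-1}. r i else 0)" .
  have H1: "H 1 1 1 = (\<Sum>j\<in>J. (- 1) ^ j * ((- 1) ^ j * complex_of_real (sqrt 2)) ^ (\<eta> 1 + (1 - \<nu> 1)))"
    by (simp add: H_def factor_def dual_factor_def sqrt2 power_add)
  have "(\<Prod>i\<in>{2..t}. r i) = (\<Prod>i\<in>{2..t-1}. r i) * r t"
  proof -
    have "{2..t} = insert t {2..t-1}" "t \<notin> {2..t-1}" using u by auto
    then show ?thesis by (simp only: prod.insert finite_atLeastAtMost mult.commute simp_thms)
  qed
  then show ?thesis unfolding total S1 S2 H1 by simp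
qed

lemma sqrt2_in_K: "complex_of_real (sqrt 2) \<in> K"
  unfolding sqrt2 using u r_in_K[of 1]
  by (auto intro!: subfield_divide[OF K] subfield_numeral[OF K])

lemma tau_vec_sqrt2:
  "tau_vec r t \<mu> (complex_of_real (sqrt 2)) = (- 1) ^ \<mu> 1 * complex_of_real (sqrt 2)"
proof -
  interpret \<sigma>: subfield_endo K "tau_vec r t \<mu>" by (rule subfield_endo_tau_vec)
  show ?thesis unfolding sqrt2 using u r_in_K[of 1] by (simp add: \<sigma>.divide_2 tau_vec_r)
qed

lemma alpha'_eq: "alpha' r i = 1 - alpha r i"
  by (simp add: alpha_def alpha'_def field_simps)

lemma algebraic_int_alpha': "i \<in> {2..t} \<Longrightarrow> algebraic_int (alpha' r i)"
  unfolding alpha'_eq by (intro algebraic_int_diff alpha_int int_imp_algebraic_int) auto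

lemma algebraic_int_sqrt2: "algebraic_int (complex_of_real (sqrt 2))"
  using algebraic_int_of_int[of 2] by (intro algebraic_int_of_real algebraic_int_sqrt int_imp_algebraic_int) auto

lemma algebraic_int_factor:
  assumes "i \<in> {1..t}"
  shows "algebraic_int (factor i a (r i))" "algebraic_int (dual_factor i a (r i))"
proof -
  have int: "algebraic_int (alpha r i)" "algebraic_int (alpha' r i)" if "i \<noteq> 1"
    using that assms alpha_int[of i] algebraic_int_alpha'[of i] by auto
  have eq: "factor i a (r i) = (if i = 1 then complex_of_real (sqrt 2) ^ a else alpha' r i ^ a * alpha r i ^ (1 - a))"
    "dual_factor i a (r i) = (if i = 1 then complex_of_real (sqrt 2) ^ (1 - a) else (- alpha' r i) ^ a * alpha r i ^ (1 - a))"
    by (auto simp: factor_def dual_factor_def sqrt2 alpha_def alpha'_def)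
  show "algebraic_int (factor i a (r i))" "algebraic_int (dual_factor i a (r i))"
    unfolding eq using int algebraic_int_sqrt2
    by (auto intro!: algebraic_int_times algebraic_int_power)
qed

lemma cnj_monomial:
  assumes "\<And>i a x. cnj (f i a x) = f i a (cnj x)"
  shows "monomial f s (\<lambda>i. cnj (r i)) = cnj (monomial f s r)"
  by (simp add: monomial_def assms)

lemma cnj_alpha: "cnj (alpha r t) = alpha' r t"
  using u by (simp add: alpha_def alpha'_def cnj_r_neg)

lemma cnj_alpha': "cnj (alpha' r t) = alpha r t"
  using cnj_alpha by (metis complex_cnj_cnj)

text \<open>
  In this form it is visible that \<open>beta\<close> is real and, with the next equation, that \<open>beta_star\<close> is
  imaginary.
\<close>

lemma beta_trace: "beta r u t s = monomial factor s r * alpha r t + cnj (monomial factor s r * alpha r t)"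
  by (simp add: beta_eq cnj_monomial cnj_factor cnj_alpha)

lemma beta_star_trace:
  "beta_star r u t s = monomial dual_factor s r * alpha r t - cnj (monomial dual_factor s r * alpha r t)"
  by (simp add: beta_star_eq cnj_monomial cnj_dual_factor cnj_alpha)

lemma beta_properties:
  "beta r u t s \<in> K" "algebraic_int (beta r u t s)" "cnj (beta r u t s) = beta r u t s"
  "beta_star r u t s \<in> K" "algebraic_int (beta_star r u t s)" "cnj (beta_star r u t s) = - beta_star r u t s"
proof -
  have t: "t \<in> {1..t}" "t \<in> {2..t}" using u by auto
  have rt: "r t \<in> K" using t r_in_K by blast
  have \<alpha>: "alpha r t \<in> K" "alpha' r t \<in> K"
    unfolding alpha_def alpha'_def using rt
    by (auto intro!: subfield_divide[OF K] subfield_add[OF K] subfield_diff[OF K] subfield_1[OF K] subfield_numeral[OF K])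
  have rK: "r i \<in> K" "cnj (r i) \<in> K" if "i \<in> {1..t-1}" for i
    using that r_in_K[of i] cnj_r_in_K[of i] by auto
  show "beta r u t s \<in> K" "beta_star r u t s \<in> K"
    unfolding beta_eq beta_star_eq monomial_def
    by (intro subfield_add[OF K] subfield_diff[OF K] subfield_mult[OF K] subfield_prod[OF K]
        factor_in_subfield dual_factor_in_subfield K rK \<alpha>; assumption)+
  have "algebraic_int (monomial factor s r * alpha r t)"
    "algebraic_int (monomial dual_factor s r * alpha r t)"
    unfolding monomial_def
    by (auto intro!: algebraic_int_times algebraic_int_prod algebraic_int_factor alpha_int t)
  then show "algebraic_int (beta r u t s)" "algebraic_int (beta_star r u t s)"
    unfolding beta_trace beta_star_trace
    by (auto intro!: algebraic_int_plus algebraic_int_diff algebraic_int_cnj simp del: complex_cnj_mult)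
  show "cnj (beta r u t s) = beta r u t s" "cnj (beta_star r u t s) = - beta_star r u t s"
    unfolding beta_trace beta_star_trace by simp_all
qed

lemma bits:
  assumes "s \<in> bit_vecs (t - 1)" "i \<in> {1..t-1}"
  shows "s i \<in> {0, 1}"
  using assms unfolding bit_vecs_def by (rule PiE_mem)

lemma finite_bits: "finite (bit_vecs (t - 1))"
  unfolding bit_vecs_def by (intro finite_PiE) auto

lemma prod_r_split: "(\<Prod>i\<in>{1..t}. r i) = r 1 * (\<Prod>i\<in>{2..t}. r i)"
proof -
  have "{1..t} = insert 1 {2..t}" using u by auto
  then show ?thesis by (simp only: prod.insert finite_atLeastAtMost) simp
qed

lemma bits_eqI:
  assumes "s \<in> bit_vecs (t - 1)" "s' \<in> bit_vecs (t - 1)" "s 1 = s' 1" "\<forall>i\<in>{2..t-1}. s i = s' i"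
  shows "s = s'"
proof (rule PiE_ext)
  show "s \<in> {1..t-1} \<rightarrow>\<^sub>E {0, 1}" "s' \<in> {1..t-1} \<rightarrow>\<^sub>E {0, 1}"
    using assms by (simp_all add: bit_vecs_def)
  fix i assume "i \<in> {1..t-1}"
  then show "s i = s' i" using assms(3,4) by (cases "i = 1") auto
qed

lemma alternating_beta_beta_star_all:
  assumes \<eta>: "\<eta> \<in> bit_vecs (t - 1)" and \<nu>: "\<nu> \<in> bit_vecs (t - 1)"
  shows "alternating {0, 1} (beta r u t \<eta> * beta_star r u t \<nu>) =
    (if \<eta> = \<nu> then \<Prod>i\<in>{1..t}. r i else 0)"
proof -
  have one: "1 \<in> {1..t-1}" using u by auto
  let ?s = "complex_of_real (sqrt 2)"
  have "(\<Sum>j\<in>{0, 1::nat}. (- 1) ^ j * ((- 1) ^ j * ?s) ^ (\<eta> 1 + (1 - \<nu> 1))) =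
      (if \<eta> 1 = \<nu> 1 then r 1 else 0)"
    using bits[OF \<eta> one] bits[OF \<nu> one] r1 by (auto simp: power2_eq_square)
  moreover have "alternating {0, 1} (beta r u t \<eta> * beta_star r u t \<nu>) =
    (\<Sum>j\<in>{0, 1}. (- 1) ^ j * ((- 1) ^ j * ?s) ^ (\<eta> 1 + (1 - \<nu> 1))) *
    (if \<forall>i\<in>{2..t-1}. \<eta> i = \<nu> i then \<Prod>i\<in>{2..t}. r i else 0)"
    using bits[OF \<eta>] bits[OF \<nu>] by (intro alternating_beta_beta_star) auto
  moreover have "\<eta> = \<nu> \<longleftrightarrow> \<eta> 1 = \<nu> 1 \<and> (\<forall>i\<in>{2..t-1}. \<eta> i = \<nu> i)"
    using bits_eqI[OF \<eta> \<nu>] by auto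
  ultimately show ?thesis unfolding prod_r_split by (simp del: One_nat_def)
qed

lemma alternating_beta_star_beta_all:
  assumes "\<eta> \<in> bit_vecs (t - 1)" "\<nu> \<in> bit_vecs (t - 1)"
  shows "alternating {0, 1} (beta_star r u t \<eta> * beta r u t \<nu>) =
    (if \<eta> = \<nu> then \<Prod>i\<in>{1..t}. r i else 0)"
  unfolding mult.commute[of "beta_star r u t \<eta>"] alternating_beta_beta_star_all[OF assms(2,1)]
  by (simp add: eq_commute)

lemma alternating_beta_beta_star_0:
  assumes \<eta>: "\<eta> \<in> bit_vecs (t - 1)" and \<nu>: "\<nu> \<in> bit_vecs (t - 1)"
  shows "alternating {0} (beta r u t \<eta> * beta_star r u t \<nu>) =
    complex_of_real (sqrt 2) ^ (\<eta> 1 + (1 - \<nu> 1)) *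
    (if \<forall>i\<in>{2..t-1}. \<eta> i = \<nu> i then \<Prod>i\<in>{2..t}. r i else 0)"
proof -
  have "alternating {0} (beta r u t \<eta> * beta_star r u t \<nu>) =
    (\<Sum>j\<in>{0}. (- 1) ^ j * ((- 1) ^ j * complex_of_real (sqrt 2)) ^ (\<eta> 1 + (1 - \<nu> 1))) *
    (if \<forall>i\<in>{2..t-1}. \<eta> i = \<nu> i then \<Prod>i\<in>{2..t}. r i else 0)"
    using bits[OF \<eta>] bits[OF \<nu>] by (intro alternating_beta_beta_star) auto
  then show ?thesis by simp
qed

text \<open>
  The alternating sum of a linear relation times \<open>g s\<close> is the coefficient at \<open>s\<close> times \<open>\<surd>d\<close>.
\<close>

lemma independent_if_dual:
  assumes fg: "\<And>s. f s \<in> K" "\<And>s. g s \<in> K"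
    and dual: "\<And>s s'. s \<in> bit_vecs (t - 1) \<Longrightarrow> s' \<in> bit_vecs (t - 1) \<Longrightarrow>
      alternating {0, 1} (f s * g s') = (if s = s' then \<Prod>i\<in>{1..t}. r i else 0)"
  shows "int_mod.independent (f ` bit_vecs (t - 1))"
proof (rule int_mod.independent_image[OF finite_bits])
  fix c :: "(nat \<Rightarrow> nat) \<Rightarrow> int" and s
  assume zero: "(\<Sum>s\<in>bit_vecs (t - 1). of_int (c s) * f s) = 0" and s: "s \<in> bit_vecs (t - 1)"
  have "0 = alternating {0, 1} ((\<Sum>s\<in>bit_vecs (t - 1). of_int (c s) * f s) * g s)"
    unfolding zero alternating_def mult_zero_left
    by (simp add: subfield_endo.fixes_Rats[OF subfield_endo_tau_vec])
  also have "(\<Sum>s\<in>bit_vecs (t - 1). of_int (c s) * f s) * g s =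
      (\<Sum>s'\<in>bit_vecs (t - 1). of_rat (of_int (c s')) * (f s' * g s))"
    by (simp add: sum_distrib_right mult.assoc)
  also have "alternating {0, 1} \<dots> =
      (\<Sum>s'\<in>bit_vecs (t - 1). of_rat (of_int (c s')) * alternating {0, 1} (f s' * g s))"
    by (rule alternating_rat_sum) (intro subfield_mult[OF K] fg)
  also have "\<dots> = (\<Sum>s'\<in>bit_vecs (t - 1). if s' = s then of_int (c s') * (\<Prod>i\<in>{1..t}. r i) else 0)"
  proof (rule sum.cong)
    fix s' assume "s' \<in> bit_vecs (t - 1)"
    from dual[OF this s]
    show "of_rat (of_int (c s')) * alternating {0, 1} (f s' * g s) =
        (if s' = s then of_int (c s') * (\<Prod>i\<in>{1..t}. r i) else 0)"
      by (simp del: One_nat_def)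
  qed simp
  also have "\<dots> = of_int (c s) * (\<Prod>i\<in>{1..t}. r i)"
    using s finite_bits by simp
  finally show "c s = 0"
    using r_nonzero by auto
qed simp

end

section \<open>Integrality of the coordinates\<close>

text \<open>
  The square of the denominator divides \<open>m\<close>.
\<close>

lemma squarefree_denominator:
  fixes x :: complex
  assumes x: "x \<in> \<rat>" and m: "squarefree m" and int: "x ^ 2 * of_int m \<in> \<int>"
  shows "x \<in> \<int>"
proof -
  obtain a b where ab: "b > 0" "Rings.coprime a b" "x = of_int a / of_int b"
    using x by (auto elim: Rats_cases')
  obtain k where k: "x ^ 2 * of_int m = of_int k"
    using int by (auto elim: Ints_cases)
  have "of_int (a ^ 2 * m) = (of_int (k * b ^ 2) :: complex)"
    using k ab by (simp add: power_divide field_simps)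
  then have "a ^ 2 * m = k * b ^ 2"
    by (simp only: of_int_eq_iff)
  then have "b ^ 2 dvd a ^ 2 * m" by simp
  moreover have "Rings.coprime (b ^ 2) (a ^ 2)"
    using ab(2) by (simp add: coprime_commute)
  ultimately have "b ^ 2 dvd m"
    using coprime_dvd_mult_right_iff by blast
  then have "b dvd 1" using m squarefreeD by blast
  then have "b = 1" using ab(1) by simp
  then show ?thesis using ab by simp
qed

text \<open>
  The sum and the difference of the two conjugates have the squares \<open>(2p)\<^sup>2 m\<close> and \<open>(2q)\<^sup>2 (2m)\<close>. Both
  are rational algebraic integers, and \<open>m\<close> and \<open>2m\<close> are squarefree, so \<open>2p\<close> and \<open>2q\<close> are integers
  \<open>a\<close> and \<open>b\<close>. The product of the conjugates is the integer \<open>(a\<^sup>2 - 2 b\<^sup>2) m / 4\<close> with \<open>m\<close> odd. So 4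
  divides \<open>a\<^sup>2 - 2 b\<^sup>2\<close>, which makes first \<open>a\<close> and then \<open>b\<close> even.
\<close>

lemma sqrt2_integer_coefficients:
  fixes p q w :: complex and m :: int
  assumes pq: "p \<in> \<rat>" "q \<in> \<rat>" and w: "w ^ 2 = of_int m" "odd m" "squarefree m"
    and int: "algebraic_int ((p + q * complex_of_real (sqrt 2)) * w)" (is "algebraic_int ?T")
      "algebraic_int ((p - q * complex_of_real (sqrt 2)) * w)" (is "algebraic_int ?T'")
  shows "p \<in> \<int>" "q \<in> \<int>"
proof -
  let ?s = "complex_of_real (sqrt 2)"
  have "complex_of_real (sqrt 2 ^ 2) = 2" by simp
  then have s2: "?s ^ 2 = 2" by (simp only: of_real_power)
  have "algebraic_int ((?T + ?T') ^ 2)"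
    by (rule algebraic_int_power[OF algebraic_int_plus[OF int]])
  moreover have "(?T + ?T') ^ 2 = (2 * p) ^ 2 * of_int m"
    unfolding w(1)[symmetric] by (simp add: power2_eq_square algebra_simps)
  ultimately have "(2 * p) ^ 2 * of_int m \<in> \<int>"
    using pq by (intro rational_algebraic_int_is_int) auto
  then have "2 * p \<in> \<int>"
    using pq by - (rule squarefree_denominator[OF _ w(3)], auto)
  then obtain a where a: "2 * p = of_int a" by (auto elim: Ints_cases)
  have "algebraic_int ((?T - ?T') ^ 2)"
    by (rule algebraic_int_power[OF algebraic_int_diff[OF int]])
  moreover have "(?T - ?T') ^ 2 = (2 * q) ^ 2 * (?s ^ 2 * w ^ 2)"
    by (simp add: power2_eq_square algebra_simps)
  ultimately have "algebraic_int ((2 * q) ^ 2 * of_int (2 * m))"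
    by (simp add: s2 w(1))
  then have "(2 * q) ^ 2 * of_int (2 * m) \<in> \<int>"
    using pq by (intro rational_algebraic_int_is_int) auto
  moreover have "squarefree (2 * m)"
    using w(2,3) by (intro squarefree_mult_coprime) (auto simp: squarefree_prime)
  ultimately have "2 * q \<in> \<int>"
    using pq by - (rule squarefree_denominator[of "2 * q" "2 * m"], auto)
  then obtain b where b: "2 * q = of_int b" by (auto elim: Ints_cases)
  have "algebraic_int (?T * ?T')"
    by (rule algebraic_int_times[OF int])
  moreover have "?T * ?T' = (p ^ 2 - q ^ 2 * ?s ^ 2) * w ^ 2"
    by (simp add: power2_eq_square algebra_simps)
  ultimately have "algebraic_int ((p ^ 2 - 2 * q ^ 2) * of_int m)"
    by (simp add: s2 w(1) mult.commute)
  then have "(p ^ 2 - 2 * q ^ 2) * of_int m \<in> \<int>"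
    using pq by (intro rational_algebraic_int_is_int) auto
  then obtain k where "(p ^ 2 - 2 * q ^ 2) * of_int m = of_int k" by (auto elim: Ints_cases)
  moreover have "((2 * p) ^ 2 - 2 * (2 * q) ^ 2) * of_int m = 4 * ((p ^ 2 - 2 * q ^ 2) * of_int m)"
    by (simp add: power_mult_distrib algebra_simps)
  ultimately have "((2 * p) ^ 2 - 2 * (2 * q) ^ 2) * of_int m = 4 * of_int k"
    by simp
  then have "of_int ((a ^ 2 - 2 * b ^ 2) * m) = (of_int (4 * k) :: complex)"
    unfolding a b by simp
  then have "(a ^ 2 - 2 * b ^ 2) * m = 4 * k"
    by (simp only: of_int_eq_iff)
  then have "4 dvd (a ^ 2 - 2 * b ^ 2) * m" by simp
  moreover have "Rings.coprime (2 ^ 2) m"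
    using w(2) by (subst coprime_power_left_iff) simp
  then have "Rings.coprime 4 m" by simp
  ultimately have dvd4: "4 dvd a ^ 2 - 2 * b ^ 2"
    using coprime_dvd_mult_left_iff by blast
  then have "even (a ^ 2 - 2 * b ^ 2)"
    by (rule dvd_trans[rotated]) simp
  then have "even a" by simp
  then obtain a' where a': "a = 2 * a'" by blast
  have "4 dvd 4 * (a' ^ 2) - (a ^ 2 - 2 * b ^ 2)"
    by (rule dvd_diff[OF _ dvd4]) simp
  then have "2 * 2 dvd 2 * b ^ 2"
    by (simp add: a' power_mult_distrib)
  then have "even b"
    by (subst (asm) dvd_mult_cancel_left) simp
  then obtain b' where b': "b = 2 * b'" by blast
  have "p = of_int a'" "q = of_int b'" using a a' b b' by simp_all
  then show "p \<in> \<int>" "q \<in> \<int>" by simp_all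
qed

context genus_field_sqrt2
begin

text \<open>
  The alternating sum of \<open>x * g s'\<close> over the automorphisms fixing \<open>\<surd>2\<close> isolates the two coordinates
  of \<open>x\<close> that differ only at the prime 2, in the form \<open>(p + q \<surd>2) \<surd>m\<close>. The index \<open>a1\<close> is the bit at
  which \<open>f\<close> carries the factor \<open>\<surd>2\<close>, and \<open>b\<close> is the one at which \<open>g\<close> does not carry it: the two
  families use opposite conventions, and the lemma serves both.
\<close>

lemma coefficients_integral:
  assumes fg: "\<And>s. f s \<in> K" "\<And>s. g s \<in> K"
    and g: "\<And>s. algebraic_int (g s)"
    and a: "{a0, a1} = {0, 1}" "a0 \<noteq> a1"
    and dual: "\<And>s s'. s \<in> bit_vecs (t - 1) \<Longrightarrow> s' \<in> bit_vecs (t - 1) \<Longrightarrow> s' 1 = b \<Longrightarrow>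
      alternating {0} (f s * g s') = (if s 1 = a1 then complex_of_real (sqrt 2) else 1) *
        (if \<forall>i\<in>{2..t-1}. s i = s' i then \<Prod>i\<in>{2..t}. r i else 0)"
    and b: "b \<in> {0, 1}"
    and int: "algebraic_int (\<Sum>s\<in>bit_vecs (t - 1). of_rat (c s) * f s)"
    and s: "s \<in> bit_vecs (t - 1)"
  shows "(of_rat (c s) :: complex) \<in> \<int>"
proof -
  let ?B = "bit_vecs (t - 1)" and ?W = "\<Prod>i\<in>{2..t}. r i" and ?s = "complex_of_real (sqrt 2)"
  let ?x = "\<Sum>s\<in>?B. of_rat (c s) * f s"
  have one: "1 \<in> {1..t-1}" using u by auto
  have upd: "s(1 := k) \<in> ?B" if "k \<in> {0, 1}" for k
    using s that one unfolding bit_vecs_def by (auto simp: PiE_iff extensional_def)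
  have a01: "a0 \<in> {0, 1}" "a1 \<in> {0, 1}" using a by auto
  define p q where "p = (of_rat (c (s(1 := a0))) :: complex)" and "q = (of_rat (c (s(1 := a1))) :: complex)"
  have pq_Rats: "p \<in> \<rat>" "q \<in> \<rat>" by (simp_all add: p_def q_def)
  let ?T = "(p + q * ?s) * ?W"
  let ?g = "g (s(1 := b))"
  have xK: "?x \<in> K"
    using fg subfield_Rats[OF K] by (intro subfield_sum[OF K] subfield_mult[OF K]) auto
  have "alternating {0} (?x * ?g) = alternating {0} (\<Sum>s'\<in>?B. of_rat (c s') * (f s' * ?g))"
    by (simp add: sum_distrib_right mult.assoc)
  also have "\<dots> = (\<Sum>s'\<in>?B. of_rat (c s') * alternating {0} (f s' * ?g))"
    by (rule alternating_rat_sum) (intro subfield_mult[OF K] fg)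
  also have "\<dots> = (\<Sum>s'\<in>{s(1 := a0), s(1 := a1)}. of_rat (c s') * alternating {0} (f s' * ?g))"
  proof (rule sum.mono_neutral_right[OF finite_bits])
    show "{s(1 := a0), s(1 := a1)} \<subseteq> ?B"
      using upd[OF a01(1)] upd[OF a01(2)] by auto
    show "\<forall>s'\<in>?B - {s(1 := a0), s(1 := a1)}. of_rat (c s') * alternating {0} (f s' * ?g) = 0"
    proof
      fix s' assume s': "s' \<in> ?B - {s(1 := a0), s(1 := a1)}"
      have "\<not> (\<forall>i\<in>{2..t-1}. s' i = (s(1 := b)) i)"
      proof
        assume "\<forall>i\<in>{2..t-1}. s' i = (s(1 := b)) i"
        then have "\<forall>i\<in>{2..t-1}. s' i = (s(1 := s' 1)) i" by auto
        moreover have "s' 1 \<in> {a0, a1}" using s' bits[of s' 1] one a(1) by auto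
        ultimately have "s' = s(1 := s' 1)"
          using s' a(1) by (intro bits_eqI upd) auto
        then show False using s' \<open>s' 1 \<in> {a0, a1}\<close> by auto
      qed
      then have "alternating {0} (f s' * ?g) = 0"
        using s' dual[of s' "s(1 := b)"] upd[OF b] by auto
      then show "of_rat (c s') * alternating {0} (f s' * ?g) = 0" by simp
    qed
  qed
  also have "\<dots> = ?T"
  proof -
    have "s(1 := a0) \<noteq> s(1 := a1)"
      using a(2) by (metis fun_upd_same)
    moreover have "alternating {0} (f (s(1 := a0)) * ?g) = ?W" "alternating {0} (f (s(1 := a1)) * ?g) = ?s * ?W"
      using dual[OF upd[OF a01(1)] upd[OF b]] dual[OF upd[OF a01(2)] upd[OF b]] a(2) by auto
    ultimately show ?thesis by (simp add: p_def q_def algebra_simps)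
  qed
  finally have T: "alternating {0} (?x * ?g) = ?T" .
  have "algebraic_int ?T"
    unfolding T[symmetric] using xK fg int g
    by (intro alternating_algebraic_int algebraic_int_times subfield_mult[OF K])
  moreover have "algebraic_int ((p - q * ?s) * ?W)"
  proof -
    \<comment> \<open>The automorphism that changes the sign of \<open>\<surd>2\<close> and fixes \<open>\<surd>m\<close>.\<close>
    define \<mu> :: "nat \<Rightarrow> nat" where "\<mu> i = (if i = 1 then 1 else 0)" for i
    interpret \<sigma>: subfield_endo K "tau_vec r t \<mu>" by (rule subfield_endo_tau_vec)
    have pq: "p \<in> \<rat>" "q \<in> \<rat>" "p \<in> K" "q \<in> K"
      using subfield_Rats[OF K] by (auto simp: p_def q_def)
    have rK: "r i \<in> K" if "i \<in> {2..t}" for i using that r_in_K[of i] by auto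
    have W: "?W \<in> K" by (intro subfield_prod[OF K] rK)
    have "tau_vec r t \<mu> ?W = ?W"
      by (subst \<sigma>.prod) (auto intro!: prod.cong rK simp: tau_vec_r \<mu>_def)
    then have "tau_vec r t \<mu> ?T = (p - q * ?s) * ?W"
      using pq W sqrt2_in_K
      by (simp add: \<sigma>.mult \<sigma>.add \<sigma>.closed \<sigma>.fixes_Rats tau_vec_sqrt2 \<mu>_def)
    moreover have "?T \<in> K" using pq W sqrt2_in_K by (simp add: \<sigma>.closed)
    ultimately show ?thesis using \<sigma>.algebraic_int \<open>algebraic_int ?T\<close> by metis
  qed
  ultimately have "p \<in> \<int>" "q \<in> \<int>"
    using sqrt2_integer_coefficients[OF pq_Rats m] by blast+
  moreover have "s = s(1 := a0) \<or> s = s(1 := a1)"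
    using bits[OF s one] a(1) by (metis fun_upd_triv insert_iff singletonD)
  ultimately show ?thesis by (auto simp: p_def q_def)
qed

section \<open>Rational coordinates and integral bases\<close>

lemma cnj_subfield:
  assumes "x \<in> field_gen (r ` {1..t-1})"
  shows "cnj x \<in> field_gen (r ` {1..t-1})"
proof -
  define L where "L = field_gen (r ` {1..t-1})"
  have F: "is_subfield L" unfolding L_def by (rule is_subfield_field_gen)
  have "is_subfield {x. cnj x \<in> L}"
    unfolding is_subfield_def
    by (auto intro: subfield_1[OF F] subfield_diff[OF F] subfield_mult[OF F] subfield_inverse[OF F])
  moreover have "r ` {1..t-1} \<subseteq> {x. cnj x \<in> L}"
  proof safe
    fix i assume i: "i \<in> {1..t-1}"
    then have "r i \<in> L"
      unfolding L_def using field_gen_superset[of "r ` {1..t-1}"] by auto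
    moreover have "\<epsilon> i \<in> L"
      using subfield_Rats[OF F] by (auto simp: \<epsilon>_def)
    ultimately show "cnj (r i) \<in> L"
      using i by (auto simp: cnj_r intro: subfield_mult[OF F])
  qed
  ultimately show ?thesis
    using field_gen_minimal assms unfolding L_def by blast
qed

text \<open>
  With \<open>e = 1\<close> this concerns the real elements of \<open>K\<close>, with \<open>e = - 1\<close> the imaginary ones. Writing
  \<open>x = y \<alpha>\<^sub>t + z \<alpha>\<^sub>t'\<close> and averaging \<open>x\<close> with \<open>e * cnj x\<close> makes the second coordinate \<open>e\<close> times the
  conjugate of the first one, and that one is expanded in products of local factors.
\<close>

lemma rational_expansion:
  assumes span: "\<And>i. i \<in> {1..t-1} \<Longrightarrow> {1, r i} \<subseteq> rat_vs.span {f i 0 (r i), f i 1 (r i)}"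
    and e: "e \<in> {1, - 1}"
    and x: "x \<in> K" "cnj x = e * x"
  obtains c where "x = (\<Sum>s\<in>bit_vecs (t - 1). of_rat (c s) *
      (monomial f s r * alpha r t + e * cnj (monomial f s r * alpha r t)))"
proof -
  let ?B = "bit_vecs (t - 1)"
  define L where "L = field_gen (r ` {1..t-1})"
  have F: "is_subfield L" unfolding L_def by (rule is_subfield_field_gen)
  have t: "{1..t} - {t} = {1..t-1}" "t \<in> {1..t}" using u by auto
  obtain a b where ab: "a \<in> L" "b \<in> L" "x = a + b * r t"
    using x(1) K_adjoin[OF t(2)] unfolding t(1) L_def[symmetric] by auto
  define y z where "y = a + b" and "z = a - b"
  have yz: "y \<in> L" "z \<in> L"
    unfolding y_def z_def using ab by (auto intro: subfield_add[OF F] subfield_diff[OF F])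
  have xyz: "x = y * alpha r t + z * alpha' r t"
    unfolding ab(3) y_def z_def alpha_def alpha'_def by (simp add: field_simps)
  have ee: "e * e = 1" "cnj e = e" using e by auto
  define Y where "Y = (y + e * cnj z) / 2"
  have "e \<in> L" using e subfield_1[OF F] subfield_uminus[OF F] by auto
  then have "Y \<in> L"
    unfolding Y_def using yz
    by (intro subfield_divide[OF F] subfield_add[OF F] subfield_mult[OF F] cnj_subfield[folded L_def] subfield_numeral[OF F])
  have "x = (x + e * cnj x) / 2"
    using x(2) ee by (simp add: mult.assoc[symmetric])
  also have "\<dots> = Y * alpha r t + e * cnj (Y * alpha r t)"
  proof -
    have "e * cnj Y = (e * cnj y + (e * e) * z) / 2"
      unfolding Y_def by (simp add: ee(2) algebra_simps)
    then have "e * cnj Y = (e * cnj y + z) / 2" using ee(1) by simp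
    then have eq: "Y * alpha r t + e * cnj (Y * alpha r t) =
        (y + e * cnj z) / 2 * alpha r t + (e * cnj y + z) / 2 * alpha' r t"
      by (simp add: Y_def cnj_alpha flip: mult.assoc)
    show ?thesis
      unfolding eq xyz by (simp add: cnj_alpha cnj_alpha' add_divide_distrib algebra_simps)
  qed
  finally have xY: "x = Y * alpha r t + e * cnj (Y * alpha r t)" .
  have "Y \<in> rat_vs.span ((\<lambda>s. \<Prod>i\<in>{1..t-1}. f i (s i) (r i)) ` ({1..t-1} \<rightarrow>\<^sub>E {0, 1}))"
  proof -
    have "L \<subseteq> rat_vs.span ((\<lambda>s. \<Prod>i\<in>{1..t-1}. f i (s i) (r i)) ` ({1..t-1} \<rightarrow>\<^sub>E {0, 1}))"
      unfolding L_def by (rule field_gen_subset_span_products) (use square_Rats span in auto)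
    with \<open>Y \<in> L\<close> show ?thesis by blast
  qed
  then have "Y \<in> rat_vs.span ((\<lambda>s. monomial f s r) ` ?B)"
    unfolding monomial_def bit_vecs_def .
  then obtain c where "Y = (\<Sum>s\<in>?B. of_rat (c s) * monomial f s r)"
    unfolding rat_vs.span_image_eq_sums[OF finite_bits] by auto
  moreover have "cnj (of_rat k) = of_rat k" for k
    by (cases k) (simp add: of_rat_rat)
  ultimately have "x = (\<Sum>s\<in>?B. of_rat (c s) * (monomial f s r * alpha r t + e * cnj (monomial f s r * alpha r t)))"
    unfolding xY by (simp add: sum_distrib_left sum_distrib_right sum.distrib algebra_simps)
  then show ?thesis by (rule that)
qed

lemma span_factor:
  assumes "i \<in> {1..t-1}"
  shows "{1, r i} \<subseteq> rat_vs.span {factor i 0 (r i), factor i 1 (r i)}"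
    and "{1, r i} \<subseteq> rat_vs.span {dual_factor i 0 (r i), dual_factor i 1 (r i)}"
proof -
  have in_span: "z \<in> rat_vs.span {x, y}" if "z = of_rat a * x + of_rat b * y" for a b and x y z :: complex
    unfolding that by (intro rat_vs.span_add rat_vs.span_scale rat_vs.span_base) auto
  let ?f = "factor i 0 (r i)" and ?f' = "factor i 1 (r i)"
  have "1 \<in> rat_vs.span {?f, ?f'}"
    by (rule in_span[where a = 1 and b = "if i = 1 then 0 else 1"]) (simp add: factor_def field_simps)
  moreover have "r i \<in> rat_vs.span {?f, ?f'}"
    by (rule in_span[where a = "if i = 1 then 0 else 1" and b = "if i = 1 then 2 else - 1"])
      (simp add: factor_def field_simps)
  ultimately show "{1, r i} \<subseteq> rat_vs.span {?f, ?f'}" by blast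
  let ?g = "dual_factor i 0 (r i)" and ?g' = "dual_factor i 1 (r i)"
  have "1 \<in> rat_vs.span {?g, ?g'}"
    by (rule in_span[where a = "if i = 1 then 0 else 1" and b = "if i = 1 then 1 else - 1"])
      (simp add: dual_factor_def field_simps)
  moreover have "r i \<in> rat_vs.span {?g, ?g'}"
    by (rule in_span[where a = "if i = 1 then 2 else 1" and b = "if i = 1 then 0 else 1"])
      (simp add: dual_factor_def field_simps)
  ultimately show "{1, r i} \<subseteq> rat_vs.span {?g, ?g'}" by blast
qed

lemma Z_basis_beta: "Z_basis (beta r u t ` bit_vecs (t - 1)) (ring_of_integers (K \<inter> \<real>))"
proof (rule Z_basisI)
  note sf = subfield_add[OF K] subfield_mult[OF K] subfield_of_int[OF K]
  let ?M = "ring_of_integers (K \<inter> \<real>)"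
  show "int_mod.independent (beta r u t ` bit_vecs (t - 1))"
    by (rule independent_if_dual[where g = "beta_star r u t"])
      (rule beta_properties alternating_beta_beta_star_all; assumption)+
  show "x + y \<in> ?M" if "x \<in> ?M" "y \<in> ?M" for x y
    using that by (auto simp: ring_of_integers_def intro: sf algebraic_int_plus)
  show "of_int n * x \<in> ?M" if "x \<in> ?M" for n x
    using that by (auto simp: ring_of_integers_def intro: sf algebraic_int_times algebraic_int_of_int)
  show "beta r u t s \<in> ?M" for s
    using beta_properties(1-3)[of s] by (auto simp: ring_of_integers_def Reals_cnj_iff)
  show "\<exists>c. x = (\<Sum>s\<in>bit_vecs (t - 1). of_rat (c s) * beta r u t s)" if "x \<in> ?M" for x
  proof -
    have "x \<in> K" "cnj x = 1 * x"
      using that by (auto simp: ring_of_integers_def Reals_cnj_iff)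
    then obtain c where "x = (\<Sum>s\<in>bit_vecs (t - 1). of_rat (c s) *
        (monomial factor s r * alpha r t + 1 * cnj (monomial factor s r * alpha r t)))"
      using rational_expansion[of factor 1 x] span_factor(1) by blast
    then show ?thesis unfolding beta_trace by auto
  qed
  show "(of_rat (c s) :: complex) \<in> \<int>"
    if "(\<Sum>s\<in>bit_vecs (t - 1). of_rat (c s) * beta r u t s) \<in> ?M" "s \<in> bit_vecs (t - 1)" for c s
  proof (rule coefficients_integral[where f = "beta r u t" and g = "beta_star r u t"
      and ?a0.0 = 0 and ?a1.0 = 1 and b = 1 and c = c and s = s])
    fix s s' assume s: "s \<in> bit_vecs (t - 1)" "s' \<in> bit_vecs (t - 1)" "s' 1 = 1"
    have "s 1 \<in> {0, 1}" using s(1) u by (intro bits) auto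
    then show "alternating {0} (beta r u t s * beta_star r u t s') =
        (if s 1 = 1 then complex_of_real (sqrt 2) else 1) *
        (if \<forall>i\<in>{2..t-1}. s i = s' i then \<Prod>i\<in>{2..t}. r i else 0)"
      using s by (auto simp: alternating_beta_beta_star_0)
  qed (use that in \<open>auto intro: beta_properties simp: ring_of_integers_def\<close>)
qed

lemma imaginary_iff: "x \<in> (\<lambda>x. \<i> * complex_of_real x) ` UNIV \<longleftrightarrow> cnj x = - x"
  by (auto simp: complex_eq_iff image_iff intro!: exI[of _ "Im x"])

lemma Z_basis_beta_star:
  "Z_basis (beta_star r u t ` bit_vecs (t - 1))
    (ring_of_integers K \<inter> (\<lambda>x. \<i> * complex_of_real x) ` UNIV)"
proof (rule Z_basisI)
  note sf = subfield_add[OF K] subfield_mult[OF K] subfield_of_int[OF K]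
  let ?M = "ring_of_integers K \<inter> (\<lambda>x. \<i> * complex_of_real x) ` UNIV"
  have M: "x \<in> ?M \<longleftrightarrow> x \<in> K \<and> algebraic_int x \<and> cnj x = - x" for x
    unfolding Int_iff imaginary_iff by (auto simp: ring_of_integers_def)
  show "int_mod.independent (beta_star r u t ` bit_vecs (t - 1))"
    by (rule independent_if_dual[where g = "beta r u t"])
      (rule beta_properties alternating_beta_star_beta_all; assumption)+
  show "x + y \<in> ?M" if "x \<in> ?M" "y \<in> ?M" for x y
    using that unfolding M by (auto intro: sf algebraic_int_plus)
  show "of_int n * x \<in> ?M" if "x \<in> ?M" for n x
    using that unfolding M by (auto intro: sf algebraic_int_times algebraic_int_of_int)
  show "beta_star r u t s \<in> ?M" for s
    unfolding M using beta_properties(4-6)[of s] by auto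
  show "\<exists>c. x = (\<Sum>s\<in>bit_vecs (t - 1). of_rat (c s) * beta_star r u t s)" if "x \<in> ?M" for x
  proof -
    have "x \<in> K" "cnj x = - 1 * x"
      using that unfolding M by auto
    then obtain c where "x = (\<Sum>s\<in>bit_vecs (t - 1). of_rat (c s) *
        (monomial dual_factor s r * alpha r t + - 1 * cnj (monomial dual_factor s r * alpha r t)))"
      using rational_expansion[of dual_factor "- 1" x] span_factor(2) by blast
    then show ?thesis unfolding beta_star_trace by auto
  qed
  show "(of_rat (c s) :: complex) \<in> \<int>"
    if "(\<Sum>s\<in>bit_vecs (t - 1). of_rat (c s) * beta_star r u t s) \<in> ?M" "s \<in> bit_vecs (t - 1)" for c s
  proof (rule coefficients_integral[where f = "beta_star r u t" and g = "beta r u t"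
      and ?a0.0 = 1 and ?a1.0 = 0 and b = 0 and c = c and s = s])
    fix s s' assume s: "s \<in> bit_vecs (t - 1)" "s' \<in> bit_vecs (t - 1)" "s' 1 = 0"
    have "s 1 \<in> {0, 1}" using s(1) u by (intro bits) auto
    then show "alternating {0} (beta_star r u t s * beta r u t s') =
        (if s 1 = 0 then complex_of_real (sqrt 2) else 1) *
        (if \<forall>i\<in>{2..t-1}. s i = s' i then \<Prod>i\<in>{2..t}. r i else 0)"
      unfolding mult.commute[of "beta_star r u t s"]
      using s by (auto simp: alternating_beta_beta_star_0)
  qed (use that(2) that(1)[unfolded M] in \<open>auto intro: beta_properties\<close>)
qed

end

section \<open>The hypotheses on the prime discriminants\<close>

lemma prime_discriminant_odd:
  assumes "prime_discriminant q" "odd q"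
  shows "q mod 4 = 1" "squarefree q" "\<not> q dvd 1"
proof -
  obtain p :: nat where p: "prime p" "odd p" "q = (- 1) ^ ((p - 1) div 2) * int p"
    using assms unfolding prime_discriminant_def by auto
  have q: "q = int p \<or> q = - int p"
    using p(3) by (cases "even ((p - 1) div 2)") auto
  have "prime (int p)" using p(1) by simp
  then have "squarefree (int p)" by (rule squarefree_prime)
  then show "squarefree q" using q by auto
  show "\<not> q dvd 1" using q \<open>prime (int p)\<close> not_prime_unit by auto
  obtain k where k: "p = 2 * k + 1" using p(2) by (auto elim: oddE)
  have "q mod 4 = 1"
  proof (cases "even k")
    case True
    then obtain l where "k = 2 * l" by blast
    then show ?thesis using p(3) k by simp
  next
    case False
    then obtain l where "k = 2 * l + 1" by (auto elim: oddE)
    then have "q = 4 * (- int l - 1) + 1" using p(3) k by simp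
    then show ?thesis by presburger
  qed
  then show "q mod 4 = 1" .
qed

text \<open>
  With \<open>q = 4 k + 1\<close>, \<open>\<alpha>\<close> is a root of \<open>X\<^sup>2 - X - k\<close>.
\<close>

lemma algebraic_int_alpha:
  assumes "r i ^ 2 = of_int q" "q mod 4 = 1"
  shows "algebraic_int (alpha r i)"
proof -
  have q: "q = 4 * k + 1" if "k = q div 4" for k
    using assms(2) that by presburger
  define k where "k = q div 4"
  show ?thesis
    unfolding algebraic_int_altdef_ipoly
  proof (intro exI conjI)
    have "alpha r i * alpha r i - alpha r i - of_int k = (r i ^ 2 - 1) / 4 - of_int k"
      by (simp add: alpha_def power2_eq_square field_simps)
    also have "\<dots> = 0" by (simp add: assms(1) q[OF k_def])
    finally show "poly (of_int_poly [:- k, - 1, 1:]) (alpha r i) = 0"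
      by (simp add: algebra_simps)
  qed simp
qed

lemma cnj_sqrt_real:
  fixes z :: complex and a :: int
  assumes "z ^ 2 = of_int a"
  shows "a > 0 \<Longrightarrow> cnj z = z" "a < 0 \<Longrightarrow> cnj z = - z"
proof -
  have re: "Re z * Re z - Im z * Im z = of_int a" and im: "Re z = 0 \<or> Im z = 0"
    using assms by (auto simp: complex_eq_iff power2_eq_square)
  show "cnj z = z" if "a > 0"
  proof -
    have "Im z = 0"
    proof (rule ccontr)
      assume "Im z \<noteq> 0"
      then have "- (Im z * Im z) = of_int a" using re im by simp
      then have "of_int a \<le> (0 :: real)" using zero_le_square[of "Im z"] by linarith
      then show False using that by simp
    qed
    then show ?thesis by (simp add: complex_eq_iff)
  qed
  show "cnj z = - z" if "a < 0"
  proof -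
    have "Re z = 0"
    proof (rule ccontr)
      assume "Re z \<noteq> 0"
      then have "Re z * Re z = of_int a" using re im by simp
      then have "of_int a \<ge> (0 :: real)" using zero_le_square[of "Re z"] by linarith
      then show False using that by simp
    qed
    then show ?thesis by (simp add: complex_eq_iff)
  qed
qed

lemma sqrt_squarefree_notin_Rats:
  fixes z :: complex
  assumes "z ^ 2 = of_int n" "squarefree n" "n \<noteq> 1"
  shows "z \<notin> \<rat>"
proof
  assume "z \<in> \<rat>"
  then have "z \<in> \<int>"
    by (rule squarefree_denominator[of _ 1]) (simp_all add: assms)
  then obtain k where "z = of_int k" by (auto elim: Ints_cases)
  then have "of_int (k ^ 2) = (of_int n :: complex)" using assms(1) by simp
  then have k: "k ^ 2 = n" by (simp only: of_int_eq_iff)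
  then have "k dvd 1" using assms(2) squarefreeD[of n k] by simp
  then have "k = 1 \<or> k = - 1" by auto
  then show False using k assms(3) by auto
qed

text \<open>
  A product of square roots of the odd \<open>q\<^sub>i\<close>, or \<open>\<surd>2\<close> times such a product, squares to a squarefree
  integer other than 1 and is therefore irrational.
\<close>

lemma genus_field_sqrt2I:
  fixes d :: int and t u :: nat and q :: "nat \<Rightarrow> int" and r :: "nat \<Rightarrow> complex"
  assumes d: "d < 0"
    and fact: "prime_discriminant_factorization d t q"
    and q1: "q 1 = 8" and odd: "\<forall>i\<in>{2..t}. odd (q i)"
    and u: "1 \<le> u" "u \<le> t - 1"
    and pos: "\<forall>i\<in>{1..u}. q i > 0" and neg: "\<forall>i\<in>{u<..t}. q i < 0"
    and r: "\<forall>i\<in>{1..t}. r i ^ 2 = of_int (q i)" and r1: "r 1 = 2 * complex_of_real (sqrt 2)"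
  shows "genus_field_sqrt2 r t u (\<Prod>i\<in>{2..t}. q i)"
proof -
  have d_prod: "d = (\<Prod>i\<in>{1..t}. q i)"
    and pd: "\<And>i. i \<in> {1..t} \<Longrightarrow> prime_discriminant (q i)"
    and cop: "\<And>i j. i \<in> {1..t} \<Longrightarrow> j \<in> {1..t} \<Longrightarrow> i \<noteq> j \<Longrightarrow> Rings.coprime (q i) (q j)"
    using fact unfolding prime_discriminant_factorization_def pairwise_def by auto
  have q_props: "q i mod 4 = 1" "squarefree (q i)" "\<not> q i dvd 1" if "i \<in> {2..t}" for i
    using prime_discriminant_odd[of "q i"] pd[of i] odd that by auto
  have sqf: "squarefree (\<Prod>i\<in>L. q i)" if "L \<subseteq> {2..t}" for L
    using that by (intro squarefree_prod_coprime cop q_props) auto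
  have oddp: "odd (\<Prod>i\<in>L. q i)" if "L \<subseteq> {2..t}" for L
  proof -
    have "finite L" using that finite_subset by blast
    then show ?thesis using that odd by (induction L) auto
  qed
  have r_prod: "(\<Prod>i\<in>L. r i) ^ 2 = of_int (\<Prod>i\<in>L. q i)" if "L \<subseteq> {1..t}" for L
    using that r by (auto simp: prod_power_distrib of_int_prod intro!: prod.cong)
  show ?thesis
  proof unfold_locales
    show "r i ^ 2 \<in> \<rat>" if "i \<in> {1..t}" for i using r that by auto
    show "(\<Prod>i\<in>L. r i) \<notin> \<rat>" if L: "L \<subseteq> {1..t}" "L \<noteq> {}" for L
    proof (cases "1 \<in> L")
      case True
      define L' where "L' = L - {1}"
      have L': "L' \<subseteq> {2..t}" "L' \<subseteq> {1..t}" "finite L" "L = insert 1 L'" "1 \<notin> L'" "finite L'"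
        using L(1) True finite_subset[OF L(1)] by (auto simp: L'_def)
      \<comment> \<open>The first discriminant 8 is not squarefree, so its root \<open>2 \<surd>2\<close> is halved.\<close>
      have "(\<Prod>i\<in>L. r i) / 2 = complex_of_real (sqrt 2) * (\<Prod>i\<in>L'. r i)"
        using L' r1 by simp
      then have "((\<Prod>i\<in>L. r i) / 2) ^ 2 = complex_of_real (sqrt 2 ^ 2) * (\<Prod>i\<in>L'. r i) ^ 2"
        by (simp only: power_mult_distrib of_real_power)
      also have "\<dots> = of_int (2 * (\<Prod>i\<in>L'. q i))"
        unfolding r_prod[OF L'(2)] by simp
      finally have "(\<Prod>i\<in>L. r i) / 2 \<notin> \<rat>"
      proof (rule sqrt_squarefree_notin_Rats)
        show "squarefree (2 * (\<Prod>i\<in>L'. q i))"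
          using sqf[OF L'(1)] oddp[OF L'(1)]
          by (intro squarefree_mult_coprime) (auto simp: squarefree_prime)
        show "2 * (\<Prod>i\<in>L'. q i) \<noteq> 1" by presburger
      qed
      then show ?thesis by auto
    next
      case False
      have L2: "L \<subseteq> {2..t}"
      proof
        fix i assume "i \<in> L"
        then show "i \<in> {2..t}" using False L(1) by (cases "i = 1") auto
      qed
      have "(\<Prod>i\<in>L. q i) \<noteq> 1"
      proof -
        obtain i where i: "i \<in> L" using L(2) by blast
        then have "q i dvd (\<Prod>i\<in>L. q i)"
          using L finite_subset by (intro dvd_prodI) auto
        then show ?thesis using q_props(3)[of i] i L2 by auto
      qed
      then show ?thesis
        using r_prod[OF L(1)] sqf[OF L2] sqrt_squarefree_notin_Rats by blast
    qed
    show "1 \<le> u" "u < t" "r 1 = 2 * complex_of_real (sqrt 2)" using u r1 by auto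
    show "cnj (r i) = r i" if "i \<in> {1..u}" for i
      using that u pos r by (intro cnj_sqrt_real(1)[of _ "q i"]) auto
    show "cnj (r i) = - r i" if "i \<in> {u<..t}" for i
      using that u neg r by (intro cnj_sqrt_real(2)[of _ "q i"]) auto
    show "cnj (\<Prod>i\<in>{1..t}. r i) = - (\<Prod>i\<in>{1..t}. r i)"
      using d r_prod[of "{1..t}"] unfolding d_prod by (intro cnj_sqrt_real(2)) auto
    show "algebraic_int (alpha r i)" if "i \<in> {2..t}" for i
      using that r q_props(1)[of i] by (intro algebraic_int_alpha[of r i "q i"]) auto
    show "(\<Prod>i\<in>{2..t}. r i) ^ 2 = of_int (\<Prod>i\<in>{2..t}. q i)" by (rule r_prod) auto
    show "odd (\<Prod>i\<in>{2..t}. q i)" by (rule oddp) auto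
    show "squarefree (\<Prod>i\<in>{2..t}. q i)" by (rule sqf) auto
  qed
qed

theorem theorem10:
  fixes d :: int and t u :: nat and q :: "nat \<Rightarrow> int" and r :: "nat \<Rightarrow> complex"
  assumes "d < 0" and "imaginary_quadratic_discriminant d"
    and "prime_discriminant_factorization d t q"
    and "q 1 = 8" and "\<forall>i\<in>{2..t}. odd (q i)"
    and "1 \<le> u" and "u \<le> t - 1"
    and "\<forall>i\<in>{1..u}. q i > 0" and "\<forall>i\<in>{u<..t}. q i < 0"
    and "\<forall>i\<in>{1..t}. r i ^ 2 = of_int (q i)" and "r 1 = 2 * complex_of_real (sqrt 2)"
  shows "Z_basis (beta r u t ` bit_vecs (t - 1)) (ring_of_integers (genus_field r t \<inter> \<real>)) \<and>
    Z_basis (beta_star r u t ` bit_vecs (t - 1))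
      (ring_of_integers (genus_field r t) \<inter> (\<lambda>x. \<i> * complex_of_real x) ` UNIV) \<and>
    (\<forall>\<eta>\<in>bit_vecs (t - 1). \<forall>\<nu>\<in>bit_vecs (t - 1).
      (\<Sum>\<mu>\<in>bit_vecs (t - 1). (- 1) ^ (\<Sum>i\<in>{1..t-1}. \<mu> i) *
         tau_vec r t \<mu> (beta r u t \<eta> * beta_star r u t \<nu>)) =
      (if \<eta> = \<nu> then (\<Prod>i\<in>{1..t}. r i) else 0))"
proof -
  interpret genus_field_sqrt2 r t u "\<Prod>i\<in>{2..t}. q i"
    by (rule genus_field_sqrt2I[OF assms(1,3-11)])
  show ?thesis
    using Z_basis_beta Z_basis_beta_star alternating_beta_beta_star_all
    unfolding alternating_def indices_bits by blast
qed

end
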